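(* Let $f$ have the series representation $$f(\tau)=\tau\sinh\left(\frac{\pi\tau}{2}\right)\sum_{m=1}^\infty K_s\left(m,i\tau,\sinh^{-1}(\pi)\right)a_m,\qquad \tau>0,$$ where the sequence of complex numbers $\{a_m\}_{m\ge1}$ satisfies $\sum_{m=1}^\infty m|a_m|<\infty$. Then for all $x>0$ $$f(x)=\frac{4}{\pi^2}\,x\sinh\left(\frac{\pi x}{2}\right)\sum_{n=1}^\infty\frac1n\,K_s\left(n,ix,\sinh^{-1}(\pi)\right)\int_0^\infty\cosh\left(\frac{\pi\tau}{2}\right)K_{i\tau}(n)f(\tau)\,d\tau .$$ If, in turn, $f$ is given by the series $$f(\tau)=\sum_{m=1}^\infty a_m K_{i\tau}(m),\qquad \tau>0,$$ with $\{a_m\}_{m\ge1}\in l_1$, i.e. $\sum_{m\ge1}|a_m|<\infty$, then for all $x>0$ $$f(x)=\frac{2}{\pi^2}\sum_{n=1}^\infty\frac{K_{ix}(n)}{n}\int_0^\infty\tau\sinh(\pi\tau)\,K_s\left(n,i\tau,\sinh^{-1}(\pi)\right)f(\tau)\,d\tau ,$$ where the integral is understood in the Abel sense, that is, as $$2\lim_{\alpha\to\frac{\pi}{2}-}\int_0^\infty\tau\sinh\left(\frac{\pi\tau}{2}\right)\cosh(\alpha\tau)\,K_s\left(n,i\tau,\sinh^{-1}(\pi)\right)f(\tau)\,d\tau .$$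
   Context: $i$ is the imaginary unit and $\sinh^{-1}(u)=\log\left(u+\sqrt{1+u^2}\right)$. $K_\nu$ is the modified Bessel (Macdonald) function, $K_\nu(x)=\int_0^\infty e^{-x\cosh u}\cosh(\nu u)\,du$ for $x>0$, $\nu\in\mathbb{C}$; thus $K_{i\tau}(n)=\int_0^\infty e^{-n\cosh u}\cos(\tau u)\,du$. The function $K_s$ is defined by $K_s(x,\nu,w)=\frac{1}{\sin(\pi\nu/2)}\int_0^w\sin(x\sinh u)\sinh(\nu u)\,du$; thus, for $\tau>0$, $K_s(n,i\tau,w)=\frac{1}{\sinh(\pi\tau/2)}\int_0^w\sin(n\sinh u)\sin(\tau u)\,du$. In the first expansion, the integral over $(0,\infty)$ is an improper one, $\int_0^\infty=\lim_{N\to\infty}\int_0^N$. *)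

theory Defs
  imports "HOL-Analysis.Analysis"
begin

text \<open>
  The Macdonald function of complex order; the defining integral converges absolutely for
  positive argument.
\<close>

definition macdonald :: "complex \<Rightarrow> real \<Rightarrow> complex" where
  "macdonald \<nu> x =
     (LBINT u=0..\<infinity>. complex_of_real (exp (- x * cosh u)) * cosh (\<nu> * complex_of_real u))"

definition Ks :: "real \<Rightarrow> complex \<Rightarrow> real \<Rightarrow> complex" where
  "Ks x \<nu> w = 1 / sin (complex_of_real pi * \<nu> / 2) *
     (LBINT u=0..ereal w. complex_of_real (sin (x * sinh u)) * sinh (\<nu> * complex_of_real u))"

text \<open>
  Integrability on bounded intervals is required explicitly because the Lebesgue integral of a
  non-integrable function is 0 by convention.
\<close>

definition has_improper_integral :: "(real \<Rightarrow> complex) \<Rightarrow> complex \<Rightarrow> bool" where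
  "has_improper_integral g J \<longleftrightarrow>
     (\<forall>N>0. interval_lebesgue_integrable lborel 0 (ereal N) g) \<and>
     ((\<lambda>N. LBINT \<tau>=0..ereal N. g \<tau>) \<longlongrightarrow> J) at_top"

lemma sin_mult_ii: "sin (\<i> * complex_of_real t) = \<i> * complex_of_real (sinh t)"
  by (simp add: sin_i_times sinh_field_def exp_minus exp_of_real)

lemma sinh_mult_ii: "sinh (\<i> * complex_of_real t) = \<i> * complex_of_real (sin t)"
  by (simp add: sinh_conv_sin sin_of_real flip: mult.assoc)

lemma cosh_mult_ii: "cosh (\<i> * complex_of_real t) = complex_of_real (cos t)"
  by (simp add: cosh_conv_cos cos_of_real flip: mult.assoc)

lemma macdonald_imaginary_order:
  "macdonald (\<i> * complex_of_real \<tau>) x =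
     complex_of_real (LBINT u=0..\<infinity>. exp (- x * cosh u) * cos (\<tau> * u))"
proof -
  have "cosh (\<i> * complex_of_real \<tau> * complex_of_real u) = complex_of_real (cos (\<tau> * u))" for u
    using cosh_mult_ii[of "\<tau> * u"] by (simp add: mult.assoc)
  then show ?thesis
    unfolding macdonald_def by (simp add: interval_lebesgue_integral_of_real flip: of_real_mult)
qed

lemma Ks_imaginary_order:
  "Ks x (\<i> * complex_of_real \<tau>) w =
     complex_of_real (1 / sinh (pi * \<tau> / 2) * (LBINT u=0..ereal w. sin (x * sinh u) * sin (\<tau> * u)))"
proof -
  have 1: "complex_of_real (sin (x * sinh u)) * sinh (\<i> * complex_of_real \<tau> * complex_of_real u)
      = \<i> * complex_of_real (sin (x * sinh u) * sin (\<tau> * u))" for u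
    using sinh_mult_ii[of "\<tau> * u"] by (simp add: mult.assoc mult.left_commute)
  have 2: "sin (complex_of_real pi * (\<i> * complex_of_real \<tau>) / 2) = \<i> * complex_of_real (sinh (pi * \<tau> / 2))"
    using sin_mult_ii[of "pi * \<tau> / 2"] by (simp add: mult_ac)
  show ?thesis
    unfolding Ks_def 1 2 interval_lebesgue_integral_mult_right interval_lebesgue_integral_of_real
    by simp
qed

end

theory Submission
  imports
    Defs
    "HOL-Complex_Analysis.Cauchy_Integral_Theorem"
    "HOL-Probability.Sinc_Integral"
    "HOL-Real_Asymp.Real_Asymp"
begin

text \<open>
  Both expansions rest on one Parseval identity. Turning the contour in Macdonald's integral by an
  angle \<open>\<beta>\<close> shows that \<open>cosh (\<beta> * \<tau>) * K\<^bsub>\<i>\<tau>\<^esub>(x)\<close> is the cosine transform of the kernel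
  \<open>h(v) = exp (- x * cos \<beta> * cosh v) * cos (x * sin \<beta> * sinh v)\<close> if \<open>\<beta> < pi / 2\<close>. In the limit
  \<open>\<beta> = pi / 2\<close> the kernel becomes \<open>cos (x * sinh v)\<close>, which is not integrable. On the other side,
  \<open>sin (n * sinh u)\<close> vanishes at \<open>u = 0\<close> and at \<open>u = arsinh pi\<close>, so an integration by parts
  turns \<open>\<tau> * sinh (pi * \<tau> / 2) * K\<^sub>s(n, \<i>\<tau>, arsinh pi)\<close> into the cosine transform over
  \<open>{0..arsinh pi}\<close> of \<open>n * cosh u * cos (n * sinh u)\<close>. For a continuous function \<open>\<gamma>\<close> on this
  interval and \<open>0 < \<beta> \<le> pi / 2\<close>, \<open>cosine_transform_parseval\<close> states that the integral over
  \<open>{0..N}\<close> of the product of the two transforms tends to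
  \<open>pi / 2\<close> times the integral of \<open>\<gamma> u * h u\<close>.
  At \<open>\<beta> = pi / 2\<close> and \<open>x = m\<close>, the substitution \<open>t = sinh u\<close> turns the integral of
  \<open>n * cosh u * cos (n * sinh u) * cos (m * sinh u)\<close> into that of \<open>n * cos (n * t) * cos (m * t)\<close>
  over \<open>{0..pi}\<close>, which is \<open>n * pi / 2\<close> if \<open>m = n\<close> and \<open>0\<close> otherwise (\<open>sinh_mode_orthogonal\<close>).

  In the first expansion \<open>f\<close> is thus the cosine transform of a continuous function, because
  \<open>\<Sum> m * norm (a m)\<close> is finite, and the inner integral equals \<open>pi\<^sup>2 / 4 * n * a n\<close>. In the second
  one, every \<open>\<alpha> < pi / 2\<close> gives absolutely convergent integrals that can be computed termwise; by
  Tannery's theorem they tend to \<open>pi\<^sup>2 / 2 * n * a n\<close>, the factor \<open>2\<close> in front of the limit included.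
  In both cases the outer series is then, up to its constant, the series that defines \<open>f\<close>.

  The delicate point is the inversion of the conditionally convergent transform, boundedly on
  \<open>{0..arsinh pi}\<close> (\<open>partial_inverse_bounded\<close>, \<open>partial_inverse_limit\<close>). The partial inverse up to
  \<open>N\<close> is the integral of \<open>h\<close> against Dirichlet kernels. On \<open>{M..}\<close> the phases
  \<open>x * sin \<beta> * sinh v \<plusminus> N * v\<close> have a second derivative that does not depend on \<open>N\<close> and is at
  least \<open>x * sin \<beta> * sinh M\<close>, so van der Corput's test makes this part small uniformly in \<open>N\<close>
  (\<open>rotated_kernel_tail_bound\<close>). On \<open>{0..M}\<close> an integration by parts produces the sine integral,
  and dominated convergence applies (\<open>local_dirichlet_limit\<close>).
\<close>

section \<open>Oscillatory integrals\<close>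

lemma DERIV_imp_continuous_on_Icc:
  fixes F f :: "real \<Rightarrow> real"
  assumes "\<And>x. x \<in> {a..b} \<Longrightarrow> (F has_real_derivative f x) (at x)"
  shows "continuous_on {a..b} F"
  by (rule continuous_at_imp_continuous_on, rule ballI, rule DERIV_isCont, rule assms)

lemma integral_by_parts_C1:
  fixes F G f g :: "real \<Rightarrow> real"
  assumes "a \<le> b"
    and F: "\<And>x. x \<in> {a..b} \<Longrightarrow> (F has_real_derivative f x) (at x)"
    and G: "\<And>x. x \<in> {a..b} \<Longrightarrow> (G has_real_derivative g x) (at x)"
    and f: "continuous_on {a..b} f" and g: "continuous_on {a..b} g"
  shows "integral {a..b} (\<lambda>x. F x * g x)
    = F b * G b - F a * G a - integral {a..b} (\<lambda>x. f x * G x)"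
proof -
  have cF: "continuous_on {a..b} F" and cG: "continuous_on {a..b} G"
    by (rule DERIV_imp_continuous_on_Icc, erule F, rule DERIV_imp_continuous_on_Icc, erule G)
  have "((\<lambda>x. F x * g x + f x * G x) has_integral (F b * G b - F a * G a)) {a..b}"
  proof (rule fundamental_theorem_of_calculus[OF \<open>a \<le> b\<close>])
    fix x assume "x \<in> {a..b}"
    from DERIV_mult[OF F[OF this] G[OF this]]
    show "((\<lambda>x. F x * G x) has_vector_derivative F x * g x + f x * G x) (at x within {a..b})"
      by (auto simp: has_real_derivative_iff_has_vector_derivative[symmetric] algebra_simps
          intro: DERIV_subset)
  qed
  then have "integral {a..b} (\<lambda>x. F x * g x + f x * G x) = F b * G b - F a * G a"
    by (rule integral_unique)
  moreover have "integral {a..b} (\<lambda>x. F x * g x + f x * G x)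
      = integral {a..b} (\<lambda>x. F x * g x) + integral {a..b} (\<lambda>x. f x * G x)"
    by (intro Henstock_Kurzweil_Integration.integral_add integrable_continuous_real
        continuous_on_mult cF cG f g)
  ultimately show ?thesis by linarith
qed

text \<open>
  Van der Corput's first derivative test: \<open>cos \<phi>\<close> is written as \<open>(1 / d) * (sin \<phi>)'\<close> and
  integrated by parts; as \<open>d\<close> is monotone and has no zero, the remaining integral is at most the
  total variation of \<open>1 / d\<close>.
\<close>

lemma abs_integral_cos_le_first_derivative:
  fixes \<phi> d e :: "real \<Rightarrow> real"
  assumes "a \<le> b" "\<mu> > 0"
    and \<phi>: "\<And>x. x \<in> {a..b} \<Longrightarrow> (\<phi> has_real_derivative d x) (at x)"
    and d: "\<And>x. x \<in> {a..b} \<Longrightarrow> (d has_real_derivative e x) (at x)"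
    and e: "continuous_on {a..b} e" "\<And>x. x \<in> {a..b} \<Longrightarrow> e x \<ge> 0"
    and \<mu>: "\<And>x. x \<in> {a..b} \<Longrightarrow> \<bar>d x\<bar> \<ge> \<mu>"
  shows "\<bar>integral {a..b} (\<lambda>x. cos (\<phi> x))\<bar> \<le> 4 / \<mu>"
proof -
  have nz: "d x \<noteq> 0" if "x \<in> {a..b}" for x using \<mu>[OF that] \<open>\<mu> > 0\<close> by auto
  have inv: "\<bar>1 / d x\<bar> \<le> 1 / \<mu>" if "x \<in> {a..b}" for x
    using \<mu>[OF that] \<open>\<mu> > 0\<close> by (simp add: frac_le)
  have cphi: "continuous_on {a..b} \<phi>" and cd: "continuous_on {a..b} d"
    by (rule DERIV_imp_continuous_on_Icc, erule \<phi>, rule DERIV_imp_continuous_on_Icc, erule d)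
  define q where "q = (\<lambda>x. e x / (d x)^2)"
  have cq: "continuous_on {a..b} q"
    unfolding q_def using nz by (intro continuous_intros e cd) auto
  have dinv: "((\<lambda>x. 1 / d x) has_real_derivative - q x) (at x)" if "x \<in> {a..b}" for x
    unfolding q_def using d[OF that] nz[OF that]
    by (auto intro!: derivative_eq_intros simp: power2_eq_square)
  have dsin: "((\<lambda>x. sin (\<phi> x)) has_real_derivative cos (\<phi> x) * d x) (at x)" if "x \<in> {a..b}" for x
    using \<phi>[OF that] by (auto intro!: derivative_eq_intros)
  have "integral {a..b} (\<lambda>x. cos (\<phi> x)) = integral {a..b} (\<lambda>x. 1 / d x * (cos (\<phi> x) * d x))"
    using nz by (intro Henstock_Kurzweil_Integration.integral_cong) auto
  also have "\<dots> = 1 / d b * sin (\<phi> b) - 1 / d a * sin (\<phi> a)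
      - integral {a..b} (\<lambda>x. - q x * sin (\<phi> x))"
    by (intro integral_by_parts_C1 dinv dsin \<open>a \<le> b\<close> continuous_intros cq cphi cd) auto
  finally have eq: "integral {a..b} (\<lambda>x. cos (\<phi> x)) = \<dots>" .
  have b1: "\<bar>1 / d x * sin (\<phi> x)\<bar> \<le> 1 / \<mu>" if "x \<in> {a..b}" for x
  proof -
    have "\<bar>1 / d x\<bar> * \<bar>sin (\<phi> x)\<bar> \<le> 1 / \<mu> * 1"
      by (intro mult_mono inv that) (use \<open>\<mu> > 0\<close> in auto)
    then show ?thesis by (simp only: abs_mult)
  qed
  have qint: "(q has_integral (- (1 / d b) - - (1 / d a))) {a..b}"
  proof (rule fundamental_theorem_of_calculus[OF \<open>a \<le> b\<close>])
    fix x assume "x \<in> {a..b}"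
    from DERIV_minus[OF dinv[OF this]]
    show "((\<lambda>x. - (1 / d x)) has_vector_derivative q x) (at x within {a..b})"
      by (auto simp: has_real_derivative_iff_has_vector_derivative[symmetric] intro: DERIV_subset)
  qed
  have "norm (integral {a..b} (\<lambda>x. - q x * sin (\<phi> x))) \<le> integral {a..b} q"
  proof (rule integral_norm_bound_integral)
    show "(\<lambda>x. - q x * sin (\<phi> x)) integrable_on {a..b}"
      by (intro integrable_continuous_real continuous_intros cq cphi)
    show "q integrable_on {a..b}" using qint by auto
    fix x assume x: "x \<in> {a..b}"
    have "q x \<ge> 0" using e(2)[OF x] by (simp add: q_def)
    then show "norm (- q x * sin (\<phi> x)) \<le> q x"
      by (simp add: abs_mult mult_left_le)
  qed
  also have "\<dots> = 1 / d a - 1 / d b" using integral_unique[OF qint] by simp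
  also have "\<dots> \<le> 1 / \<mu> + 1 / \<mu>"
  proof -
    have "\<bar>1 / d a\<bar> \<le> 1 / \<mu>" "\<bar>1 / d b\<bar> \<le> 1 / \<mu>"
      by (intro inv; use \<open>a \<le> b\<close> in simp)+
    then show ?thesis by linarith
  qed
  finally have b2: "\<bar>integral {a..b} (\<lambda>x. - q x * sin (\<phi> x))\<bar> \<le> 2 / \<mu>" by simp
  have "4 / \<mu> = 1 / \<mu> + 1 / \<mu> + 2 / \<mu>" by simp
  moreover have "\<bar>1 / d a * sin (\<phi> a)\<bar> \<le> 1 / \<mu>" "\<bar>1 / d b * sin (\<phi> b)\<bar> \<le> 1 / \<mu>"
    by (intro b1; use \<open>a \<le> b\<close> in simp)+
  ultimately show ?thesis unfolding eq using b2 by linarith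
qed

text \<open>
  The second derivative test on an interval where the derivative \<open>d\<close> of the phase does not change
  its sign. It grows at the rate \<open>l\<close> at least, hence \<open>\<bar>d\<bar> \<ge> sqrt l\<close> away from a piece of length
  \<open>1 / sqrt l\<close> at one end, on which the integrand is bounded by \<open>1\<close>.
\<close>

lemma abs_integral_cos_le_second_derivative_aux:
  fixes \<phi> d e :: "real \<Rightarrow> real"
  assumes "a \<le> b" "l > 0"
    and \<phi>: "\<And>x. x \<in> {a..b} \<Longrightarrow> (\<phi> has_real_derivative d x) (at x)"
    and d: "\<And>x. x \<in> {a..b} \<Longrightarrow> (d has_real_derivative e x) (at x)"
    and e: "continuous_on {a..b} e" "\<And>x. x \<in> {a..b} \<Longrightarrow> e x \<ge> l"
    and da: "d a \<ge> 0 \<or> d b \<le> 0"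
  shows "\<bar>integral {a..b} (\<lambda>x. cos (\<phi> x))\<bar> \<le> 5 / sqrt l"
proof -
  have cphi: "continuous_on {a..b} \<phi>"
    by (rule DERIV_imp_continuous_on_Icc, erule \<phi>)
  have trivial: "\<bar>integral {s..t} (\<lambda>x. cos (\<phi> x))\<bar> \<le> t - s" if "a \<le> s" "s \<le> t" "t \<le> b" for s t
  proof -
    have "norm (integral {s..t} (\<lambda>x. cos (\<phi> x))) \<le> 1 * (t - s)"
    proof (rule integral_bound[OF that(2)])
      show "continuous_on {s..t} (\<lambda>x. cos (\<phi> x))"
        by (intro continuous_intros continuous_on_subset[OF cphi]) (use that in simp)
    qed simp
    then show ?thesis by simp
  qed
  have grow: "d t - d s \<ge> l * (t - s)" if "a \<le> s" "s \<le> t" "t \<le> b" for s t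
  proof (cases "s = t")
    case False
    with that have "s < t" by simp
    moreover have "(d has_real_derivative e x) (at x)" if "s \<le> x" "x \<le> t" for x
      using d[of x] that \<open>a \<le> s\<close> \<open>t \<le> b\<close> by simp
    ultimately obtain z where "z > s" "z < t" "d t - d s = (t - s) * e z"
      using MVT2[of s t d e] by blast
    moreover have "l * (t - s) \<le> e z * (t - s)"
      by (intro mult_right_mono e(2)) (use that calculation in auto)
    ultimately show ?thesis by (simp add: mult.commute)
  qed auto
  define \<delta> where "\<delta> = 1 / sqrt l"
  have \<delta>: "\<delta> > 0" "l * \<delta> = sqrt l" "4 / sqrt l = 4 * \<delta>" "5 / sqrt l = 5 * \<delta>"
    using \<open>l > 0\<close> by (auto simp: \<delta>_def real_div_sqrt)
  show ?thesis
  proof (cases "b \<le> a + \<delta>")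
    case True
    then show ?thesis using trivial[OF order_refl \<open>a \<le> b\<close> order_refl] \<delta> by linarith
  next
    case False
    have split: "integral {a..b} (\<lambda>x. cos (\<phi> x)) =
      integral {a..c} (\<lambda>x. cos (\<phi> x)) + integral {c..b} (\<lambda>x. cos (\<phi> x))" if "a \<le> c" "c \<le> b" for c
      by (rule Henstock_Kurzweil_Integration.integral_combine[symmetric, OF that])
         (intro integrable_continuous_real continuous_intros cphi)
    have e0: "e x \<ge> 0" if "x \<in> {a..b}" for x
      using e(2)[OF that] \<open>l > 0\<close> by simp
    have main: "\<bar>integral {s..t} (\<lambda>x. cos (\<phi> x))\<bar> \<le> 4 / sqrt l"
      if "a \<le> s" "s \<le> t" "t \<le> b" "\<And>x. x \<in> {s..t} \<Longrightarrow> \<bar>d x\<bar> \<ge> sqrt l" for s t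
    proof (rule abs_integral_cos_le_first_derivative[where \<phi> = \<phi> and d = d and e = e])
      show "continuous_on {s..t} e" using that by (intro continuous_on_subset[OF e(1)]) simp
    qed (use that(1-3) \<open>l > 0\<close> in \<open>simp_all add: that(4) \<phi> d e0\<close>)
    from da show ?thesis
    proof
      assume "d a \<ge> 0"
      have "\<bar>d x\<bar> \<ge> sqrt l" if "x \<in> {a + \<delta>..b}" for x
      proof -
        have "l * \<delta> \<le> l * (x - a)" using that \<open>l > 0\<close> by simp
        also have "\<dots> \<le> d x - d a" using grow[of a x] that \<delta>(1) by auto
        finally show ?thesis using \<open>d a \<ge> 0\<close> \<delta>(2) by linarith
      qed
      then have "\<bar>integral {a + \<delta>..b} (\<lambda>x. cos (\<phi> x))\<bar> \<le> 4 / sqrt l"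
        using False \<delta>(1) by (intro main) auto
      moreover have "\<bar>integral {a..a + \<delta>} (\<lambda>x. cos (\<phi> x))\<bar> \<le> \<delta>"
        using trivial[of a "a + \<delta>"] False \<delta>(1) by auto
      moreover note split[of "a + \<delta>"]
      ultimately show ?thesis using False \<delta> by linarith
    next
      assume "d b \<le> 0"
      have "\<bar>d x\<bar> \<ge> sqrt l" if "x \<in> {a..b - \<delta>}" for x
      proof -
        have "l * \<delta> \<le> l * (b - x)" using that \<open>l > 0\<close> by simp
        also have "\<dots> \<le> d b - d x" using grow[of x b] that \<delta>(1) by auto
        finally show ?thesis using \<open>d b \<le> 0\<close> \<delta>(2) by linarith
      qed
      then have "\<bar>integral {a..b - \<delta>} (\<lambda>x. cos (\<phi> x))\<bar> \<le> 4 / sqrt l"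
        using False \<delta>(1) by (intro main) auto
      moreover have "\<bar>integral {b - \<delta>..b} (\<lambda>x. cos (\<phi> x))\<bar> \<le> \<delta>"
        using trivial[of "b - \<delta>" b] False \<delta>(1) by auto
      moreover note split[of "b - \<delta>"]
      ultimately show ?thesis using False \<delta> by linarith
    qed
  qed
qed

lemma abs_integral_cos_le_second_derivative:
  fixes \<phi> d e :: "real \<Rightarrow> real"
  assumes "a \<le> b" "l > 0"
    and \<phi>: "\<And>x. x \<in> {a..b} \<Longrightarrow> (\<phi> has_real_derivative d x) (at x)"
    and d: "\<And>x. x \<in> {a..b} \<Longrightarrow> (d has_real_derivative e x) (at x)"
    and e: "continuous_on {a..b} e" "\<And>x. x \<in> {a..b} \<Longrightarrow> e x \<ge> l"
  shows "\<bar>integral {a..b} (\<lambda>x. cos (\<phi> x))\<bar> \<le> 10 / sqrt l"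
proof -
  have cphi: "continuous_on {a..b} \<phi>"
    by (rule DERIV_imp_continuous_on_Icc, erule \<phi>)
  have pos: "5 / sqrt l \<ge> 0" using \<open>l > 0\<close> by simp
  have ten: "10 / sqrt l = 2 * (5 / sqrt l)" by simp
  have half: "\<bar>integral {s..t} (\<lambda>x. cos (\<phi> x))\<bar> \<le> 5 / sqrt l"
    if "a \<le> s" "s \<le> t" "t \<le> b" "d s \<ge> 0 \<or> d t \<le> 0" for s t
  proof (rule abs_integral_cos_le_second_derivative_aux[where \<phi> = \<phi> and d = d and e = e])
    show "continuous_on {s..t} e" using that by (intro continuous_on_subset[OF e(1)]) simp
  qed (use that \<open>l > 0\<close> in \<open>simp_all add: \<phi> d e(2)\<close>)
  show ?thesis
  proof (cases "d a \<ge> 0 \<or> d b \<le> 0")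
    case True
    from half[OF order_refl \<open>a \<le> b\<close> order_refl this] pos ten show ?thesis by linarith
  next
    case False
    have "continuous_on {a..b} d"
      by (rule DERIV_imp_continuous_on_Icc, erule d)
    then have "\<exists>c. a \<le> c \<and> c \<le> b \<and> d c = 0"
      using False \<open>a \<le> b\<close> by (intro IVT') auto
    then obtain c where c: "a \<le> c" "c \<le> b" "d c = 0" by blast
    have "integral {a..b} (\<lambda>x. cos (\<phi> x)) =
      integral {a..c} (\<lambda>x. cos (\<phi> x)) + integral {c..b} (\<lambda>x. cos (\<phi> x))"
      by (rule Henstock_Kurzweil_Integration.integral_combine[symmetric, OF c(1,2)])
         (intro integrable_continuous_real continuous_intros cphi)
    moreover have "\<bar>integral {a..c} (\<lambda>x. cos (\<phi> x))\<bar> \<le> 5 / sqrt l"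
      "\<bar>integral {c..b} (\<lambda>x. cos (\<phi> x))\<bar> \<le> 5 / sqrt l"
      by (intro half; use c in simp)+
    ultimately show ?thesis using ten by linarith
  qed
qed

text \<open>
  A decreasing weight is removed from an oscillatory integral by an integration by parts against
  the running integral of \<open>g\<close>.
\<close>

lemma abs_integral_decreasing_mult_le:
  fixes w w' g :: "real \<Rightarrow> real"
  assumes "a \<le> b"
    and w: "\<And>x. x \<in> {a..b} \<Longrightarrow> (w has_real_derivative w' x) (at x)"
    and w': "continuous_on {a..b} w'" "\<And>x. x \<in> {a..b} \<Longrightarrow> w' x \<le> 0"
    and wb: "w b \<ge> 0"
    and g: "continuous_on UNIV g"
    and C: "\<And>t. t \<in> {a..b} \<Longrightarrow> \<bar>integral {a..t} g\<bar> \<le> C"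
  shows "\<bar>integral {a..b} (\<lambda>x. w x * g x)\<bar> \<le> C * w a"
proof -
  \<comment> \<open>The base point \<open>a - 1\<close> makes \<open>G\<close> differentiable on both sides of \<open>a\<close>.\<close>
  define G where "G = (\<lambda>t. integral {a - 1..t} g - integral {a - 1..a} g)"
  have Geq: "G t = integral {a..t} g" if "t \<in> {a..b}" for t
  proof -
    have "integral {a - 1..a} g + integral {a..t} g = integral {a - 1..t} g"
      using that by (intro Henstock_Kurzweil_Integration.integral_combine integrable_continuous_real
          continuous_on_subset[OF g]) auto
    then show ?thesis by (simp add: G_def)
  qed
  have dG: "(G has_real_derivative g x) (at x)" if "x \<in> {a..b}" for x
  proof -
    have "((\<lambda>t. integral {a - 1..t} g) has_real_derivative g x) (at x within {a - 1..b + 1})"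
      using that by (intro integral_has_real_derivative continuous_on_subset[OF g]) auto
    moreover have "at x within {a - 1..b + 1} = at x"
      using that by (intro at_within_interior) auto
    ultimately show ?thesis unfolding G_def by (auto intro!: derivative_eq_intros)
  qed
  have cG: "continuous_on {a..b} G"
    by (rule DERIV_imp_continuous_on_Icc, erule dG)
  have "integral {a..b} (\<lambda>x. w x * g x) = w b * G b - w a * G a - integral {a..b} (\<lambda>x. w' x * G x)"
    by (intro integral_by_parts_C1 w dG \<open>a \<le> b\<close> w' continuous_on_subset[OF g]) auto
  moreover have "w a * G a = 0" by (simp add: G_def)
  moreover have "\<bar>w b * G b\<bar> \<le> w b * C"
  proof -
    have "\<bar>G b\<bar> \<le> C" using C[of b] Geq[of b] \<open>a \<le> b\<close> by simp
    then show ?thesis using wb by (simp add: abs_mult mult_left_mono)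
  qed
  moreover have "((\<lambda>x. - w' x * C) has_integral (- w b * C - - w a * C)) {a..b}"
  proof (rule fundamental_theorem_of_calculus[OF \<open>a \<le> b\<close>])
    fix x assume "x \<in> {a..b}"
    from DERIV_cmult_right[OF DERIV_minus[OF w[OF this]], of C]
    show "((\<lambda>x. - w x * C) has_vector_derivative - w' x * C) (at x within {a..b})"
      by (auto simp: has_real_derivative_iff_has_vector_derivative[symmetric] intro: DERIV_subset)
  qed
  note I = this
  have "norm (integral {a..b} (\<lambda>x. w' x * G x)) \<le> integral {a..b} (\<lambda>x. - w' x * C)"
  proof (rule integral_norm_bound_integral)
    show "(\<lambda>x. w' x * G x) integrable_on {a..b}"
      by (intro integrable_continuous_real continuous_intros w' cG)
    show "(\<lambda>x. - w' x * C) integrable_on {a..b}" using I by auto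
    fix x assume x: "x \<in> {a..b}"
    show "norm (w' x * G x) \<le> - w' x * C"
    proof -
      have "\<bar>w' x\<bar> * \<bar>G x\<bar> \<le> \<bar>w' x\<bar> * C"
        using C[OF x] Geq[OF x] by (intro mult_left_mono) auto
      then show ?thesis using w'(2)[OF x] by (simp add: abs_mult)
    qed
  qed
  moreover have "integral {a..b} (\<lambda>x. - w' x * C) = C * w a - w b * C"
    using integral_unique[OF I] by simp
  ultimately show ?thesis unfolding real_norm_def by linarith
qed

section \<open>The Macdonald function of imaginary order\<close>

text \<open>
  The real part of \<open>exp (- x * cosh (v + \<i> * \<beta>))\<close>, for real \<open>v\<close> and \<open>\<beta>\<close>.
\<close>

definition rotated_kernel :: "real \<Rightarrow> real \<Rightarrow> real \<Rightarrow> real" where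
  "rotated_kernel x \<beta> v = exp (- x * cos \<beta> * cosh v) * cos (x * sin \<beta> * sinh v)"

text \<open>
  The Macdonald function of order \<open>\<i> * \<tau>\<close>, which is real for real \<open>\<tau>\<close> and \<open>x > 0\<close>.
\<close>

definition macdonald_im :: "real \<Rightarrow> real \<Rightarrow> real" where
  "macdonald_im \<tau> x = (LBINT u=0..\<infinity>. exp (- x * cosh u) * cos (\<tau> * u))"

lemma cosh_complex_of_real: "cosh (complex_of_real y) = complex_of_real (cosh y)"
  and sinh_complex_of_real: "sinh (complex_of_real y) = complex_of_real (sinh y)"
  by (simp_all add: cosh_field_def sinh_field_def exp_of_real flip: of_real_minus)

text \<open>
  Cauchy's theorem for \<open>exp (- x * cosh z + \<i> * \<tau> * z)\<close> on the rectangle with the corners \<open>0\<close>,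
  \<open>R\<close>, \<open>R + \<i> * \<beta>\<close> and \<open>\<i> * \<beta>\<close>, in the form of differences of a primitive \<open>\<Phi>\<close>. After taking
  real parts the left side contributes nothing, and the right side gives the error term.
\<close>

lemma contour_rotation_bound:
  fixes x \<beta> \<tau> R :: real
  assumes "x > 0" "0 \<le> \<beta>" "\<beta> \<le> pi / 2" "0 \<le> R"
  shows "\<bar>exp (\<tau> * \<beta>) * integral {0..R} (\<lambda>v. exp (- x * cosh v) * cos (\<tau> * v))
     - integral {0..R} (\<lambda>v. exp (- x * cos \<beta> * cosh v) * cos (x * sin \<beta> * sinh v - \<tau> * v))\<bar>
     \<le> \<beta> * exp (2 * \<bar>\<tau>\<bar> * \<beta>) * exp (- x * cos \<beta> * cosh R)"
proof -
  define F :: "complex \<Rightarrow> complex" where "F z = exp (- of_real x * cosh z + \<i> * of_real \<tau> * z)" for z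
  have "F holomorphic_on UNIV"
    unfolding F_def cosh_field_def by (intro holomorphic_intros) auto
  then obtain \<Phi> where \<Phi>: "(\<Phi> has_field_derivative F z) (at z)" for z
    using holomorphic_convex_primitive'[of UNIV F] by auto
  \<comment> \<open>The point of the rectangle with abscissa \<open>v\<close> and ordinate \<open>y\<close>.\<close>
  define p where "p v y = Complex v y" for v y :: real
  have p: "p v y = of_real v + \<i> * of_real y" for v y by (simp add: p_def complex_eq_iff)
  have cosh_p: "cosh (p v y) = Complex (cosh v * cos y) (sinh v * sin y)" for v y
    by (simp add: p cosh_add cosh_mult_ii sinh_mult_ii cosh_complex_of_real sinh_complex_of_real complex_eq_iff)
  have F_p: "F (p v y) = exp (Complex (- x * cos y * cosh v - \<tau> * y) (- (x * sin y * sinh v - \<tau> * v)))" for v y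
    unfolding F_def cosh_p by (rule arg_cong[where f=exp]) (simp add: p complex_eq_iff algebra_simps)
  have norm_F: "norm (F (p v y)) = exp (- x * cos y * cosh v - \<tau> * y)" for v y
    unfolding F_p by simp
  have Re_F: "Re (F (p v y)) = exp (- (\<tau> * y)) * (exp (- x * cos y * cosh v) * cos (x * sin y * sinh v - \<tau> * v))" for v y
    unfolding F_p Re_exp cos_minus complex.sel by (simp add: exp_diff exp_minus field_simps)
  have horizontal: "((\<lambda>v. F (p v y)) has_integral (\<Phi> (p R y) - \<Phi> (p 0 y))) {0..R}" for y
  proof (rule fundamental_theorem_of_calculus[OF \<open>0 \<le> R\<close>])
    fix v :: real
    have "((\<lambda>v. p v y) has_vector_derivative 1) (at v within {0..R})"
      unfolding p by (auto intro!: derivative_eq_intros)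
    from field_vector_diff_chain_within[OF this, of \<Phi> "F (p v y)"] \<Phi>
    show "((\<lambda>v. \<Phi> (p v y)) has_vector_derivative F (p v y)) (at v within {0..R})"
      by (auto simp: o_def intro: has_field_derivative_at_within)
  qed
  have vertical: "((\<lambda>y. \<i> * F (p v y)) has_integral (\<Phi> (p v \<beta>) - \<Phi> (p v 0))) {0..\<beta>}" for v
  proof (rule fundamental_theorem_of_calculus[OF \<open>0 \<le> \<beta>\<close>])
    fix y :: real
    have "((\<lambda>y. p v y) has_vector_derivative \<i>) (at y within {0..\<beta>})"
      unfolding p by (auto intro!: derivative_eq_intros)
    from field_vector_diff_chain_within[OF this, of \<Phi> "F (p v y)"] \<Phi>
    show "((\<lambda>y. \<Phi> (p v y)) has_vector_derivative \<i> * F (p v y)) (at y within {0..\<beta>})"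
      by (auto simp: o_def intro: has_field_derivative_at_within)
  qed
  have hor_Re: "exp (- (\<tau> * y)) * integral {0..R} (\<lambda>v. exp (- x * cos y * cosh v) * cos (x * sin y * sinh v - \<tau> * v))
      = Re (\<Phi> (p R y) - \<Phi> (p 0 y))" for y
  proof -
    have "((\<lambda>v. Re (F (p v y))) has_integral Re (\<Phi> (p R y) - \<Phi> (p 0 y))) {0..R}"
      using has_integral_linear[OF horizontal bounded_linear_Re] by (simp add: o_def)
    from integral_unique[OF this] show ?thesis unfolding Re_F
      by (simp only: integral_mult_right)
  qed
  have zero: "Re (\<Phi> (p 0 \<beta>) - \<Phi> (p 0 0)) = 0"
  proof -
    have "((\<lambda>y. Re (\<i> * F (p 0 y))) has_integral Re (\<Phi> (p 0 \<beta>) - \<Phi> (p 0 0))) {0..\<beta>}"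
      using has_integral_linear[OF vertical bounded_linear_Re] by (simp add: o_def)
    moreover have "Re (\<i> * F (p 0 y)) = 0" for y unfolding F_p by (simp add: Im_exp)
    ultimately have "((\<lambda>y. 0::real) has_integral Re (\<Phi> (p 0 \<beta>) - \<Phi> (p 0 0))) {0..\<beta>}"
      by (simp only:)
    then show ?thesis by (rule has_integral_unique) (rule has_integral_0)
  qed
  have small: "norm (\<Phi> (p R \<beta>) - \<Phi> (p R 0)) \<le> exp (\<bar>\<tau>\<bar> * \<beta>) * exp (- x * cos \<beta> * cosh R) * \<beta>"
  proof -
    have "norm (\<i> * F (p R y)) \<le> exp (\<bar>\<tau>\<bar> * \<beta>) * exp (- x * cos \<beta> * cosh R)" if "y \<in> cbox 0 \<beta>" for y
    proof -
      have "cos \<beta> \<le> cos y" using that assms by (intro cos_monotone_0_pi_le) auto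
      then have "x * cos \<beta> * cosh R \<le> x * cos y * cosh R"
        using assms by (intro mult_right_mono mult_left_mono) auto
      moreover have "- (\<tau> * y) \<le> \<bar>\<tau>\<bar> * \<beta>"
      proof -
        have "(- \<tau>) * y \<le> \<bar>\<tau>\<bar> * y" using that by (intro mult_right_mono) auto
        then have "- (\<tau> * y) \<le> \<bar>\<tau>\<bar> * y" by simp
        also have "\<dots> \<le> \<bar>\<tau>\<bar> * \<beta>" using that by (simp add: mult_left_mono)
        finally show ?thesis .
      qed
      ultimately have "- x * cos y * cosh R - \<tau> * y \<le> \<bar>\<tau>\<bar> * \<beta> + - x * cos \<beta> * cosh R" by simp
      then show ?thesis unfolding norm_mult norm_F by (simp add: exp_add[symmetric])
    qed
    from has_integral_bound[OF _ vertical[of R, unfolded box_real(2)[symmetric]] this]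
    show ?thesis using assms by simp
  qed
  have "\<bar>integral {0..R} (\<lambda>v. exp (- x * cosh v) * cos (\<tau> * v))
     - exp (- (\<tau> * \<beta>)) * integral {0..R} (\<lambda>v. exp (- x * cos \<beta> * cosh v) * cos (x * sin \<beta> * sinh v - \<tau> * v))\<bar>
     = \<bar>Re (\<Phi> (p R 0) - \<Phi> (p 0 0)) - Re (\<Phi> (p R \<beta>) - \<Phi> (p 0 \<beta>))\<bar>"
    unfolding hor_Re[symmetric] by simp
  also have "\<dots> = \<bar>Re (\<Phi> (p R \<beta>) - \<Phi> (p R 0))\<bar>"
    using zero by simp
  also have "\<dots> \<le> exp (\<bar>\<tau>\<bar> * \<beta>) * exp (- x * cos \<beta> * cosh R) * \<beta>"
    using abs_Re_le_cmod small order_trans by blast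
  finally have le: "exp (\<tau> * \<beta>) * \<bar>integral {0..R} (\<lambda>v. exp (- x * cosh v) * cos (\<tau> * v))
     - exp (- (\<tau> * \<beta>)) * integral {0..R} (\<lambda>v. exp (- x * cos \<beta> * cosh v) * cos (x * sin \<beta> * sinh v - \<tau> * v))\<bar>
     \<le> exp (\<bar>\<tau>\<bar> * \<beta>) * (exp (\<bar>\<tau>\<bar> * \<beta>) * exp (- x * cos \<beta> * cosh R) * \<beta>)"
    using assms by (intro mult_mono) (auto intro: mult_right_mono)
  have pull: "exp (\<tau> * \<beta>) * \<bar>A - exp (- (\<tau> * \<beta>)) * B\<bar> = \<bar>exp (\<tau> * \<beta>) * A - B\<bar>" for A B
  proof -
    have "exp (\<tau> * \<beta>) * \<bar>A - exp (- (\<tau> * \<beta>)) * B\<bar> = \<bar>exp (\<tau> * \<beta>) * (A - exp (- (\<tau> * \<beta>)) * B)\<bar>"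
      by (simp add: abs_mult)
    also have "exp (\<tau> * \<beta>) * (A - exp (- (\<tau> * \<beta>)) * B) = exp (\<tau> * \<beta>) * A - B"
      by (simp add: exp_minus field_simps)
    finally show ?thesis .
  qed
  have square: "exp (2 * \<bar>\<tau>\<bar> * \<beta>) = exp (\<bar>\<tau>\<bar> * \<beta>) * exp (\<bar>\<tau>\<bar> * \<beta>)"
    by (simp flip: exp_add)
  show ?thesis
    unfolding square by (rule order_trans[OF le[unfolded pull]]) (simp only: mult_ac order_refl)
qed

text \<open>
  Averaging over \<open>\<tau>\<close> and \<open>- \<tau>\<close> removes the odd part of the rotated integrand.
\<close>

lemma rotated_kernel_integral_bound:
  fixes x \<beta> \<tau> R :: real
  assumes "x > 0" "0 \<le> \<beta>" "\<beta> \<le> pi / 2" "0 \<le> R"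
  shows "\<bar>cosh (\<beta> * \<tau>) * integral {0..R} (\<lambda>v. exp (- x * cosh v) * cos (\<tau> * v))
     - integral {0..R} (\<lambda>v. rotated_kernel x \<beta> v * cos (\<tau> * v))\<bar>
     \<le> \<beta> * exp (2 * \<bar>\<tau>\<bar> * \<beta>) * exp (- x * cos \<beta> * cosh R)"
proof -
  define A where "A = integral {0..R} (\<lambda>v. exp (- x * cosh v) * cos (\<tau> * v))"
  define B where "B t = integral {0..R} (\<lambda>v. exp (- x * cos \<beta> * cosh v) * cos (x * sin \<beta> * sinh v - t * v))" for t
  define E where "E = \<beta> * exp (2 * \<bar>\<tau>\<bar> * \<beta>) * exp (- x * cos \<beta> * cosh R)"
  have "\<bar>exp (\<tau> * \<beta>) * A - B \<tau>\<bar> \<le> E" "\<bar>exp (- \<tau> * \<beta>) * A - B (- \<tau>)\<bar> \<le> E"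
    using contour_rotation_bound[OF assms, of \<tau>] contour_rotation_bound[OF assms, of "- \<tau>"]
    by (simp_all add: A_def B_def E_def)
  moreover have "B \<tau> + B (- \<tau>) = 2 * integral {0..R} (\<lambda>v. rotated_kernel x \<beta> v * cos (\<tau> * v))"
  proof -
    have "B \<tau> + B (- \<tau>) = integral {0..R} (\<lambda>v. 2 * (rotated_kernel x \<beta> v * cos (\<tau> * v)))"
      unfolding B_def
      by (subst Henstock_Kurzweil_Integration.integral_add[symmetric])
         (auto simp: rotated_kernel_def cos_diff cos_add algebra_simps
           intro!: integrable_continuous_real continuous_intros)
    then show ?thesis by simp
  qed
  moreover have "2 * cosh (\<beta> * \<tau>) * A = exp (\<tau> * \<beta>) * A + exp (- \<tau> * \<beta>) * A"
    by (simp add: cosh_field_def algebra_simps)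
  ultimately show ?thesis unfolding A_def[symmetric] E_def[symmetric] by linarith
qed

lemma le_cosh_real: "u \<le> cosh (u::real)"
proof (cases "u \<le> 0")
  case True
  then show ?thesis using cosh_real_pos[of u] by linarith
next
  case False
  then have "1 + u + u^2/2 \<le> exp u" using exp_lower_Taylor_quadratic by simp
  moreover have "0 \<le> (u - 1)^2" by simp
  ultimately have "2 * u \<le> exp u" by (simp add: power2_eq_square algebra_simps)
  moreover have "2 * cosh u = exp u + exp (- u)" by (simp add: cosh_field_def)
  ultimately show ?thesis using exp_gt_zero[of "- u"] by linarith
qed

lemma macdonald_integrand_continuous: "continuous_on S (\<lambda>u. exp (- x * cosh u) * cos (\<tau> * u :: real))"
  by (intro continuous_intros)

lemma set_integrable_Ioi_iff_Ici:
  fixes f :: "real \<Rightarrow> 'a::{banach, second_countable_topology}"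
  shows "set_integrable lborel {a<..} f \<longleftrightarrow> set_integrable lborel {a..} f"
proof
  assume "set_integrable lborel {a<..} f"
  moreover have "(\<lambda>x. indicator {a} x *\<^sub>R f x) = (\<lambda>x. indicator {a} x *\<^sub>R f a)"
    by (auto simp: indicator_def)
  then have "set_integrable lborel {a} f" by (simp add: set_integrable_def)
  ultimately have "set_integrable lborel ({a} \<union> {a<..}) f" by (intro set_integrable_Un) auto
  moreover have "{a} \<union> {a<..} = {a..}" by auto
  ultimately show "set_integrable lborel {a..} f" by simp
next
  assume "set_integrable lborel {a..} f"
  then show "set_integrable lborel {a<..} f" by (rule set_integrable_subset) auto
qed

lemma set_integral_Ioi_eq_Ici:
  fixes f :: "real \<Rightarrow> 'a::{banach, second_countable_topology}"
  assumes "set_integrable lborel {a..} f"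
  shows "set_lebesgue_integral lborel {a<..} f = set_lebesgue_integral lborel {a..} f"
  unfolding set_lebesgue_integral_def
proof (rule integral_cong_AE)
  show "AE x in lborel. indicator {a<..} x *\<^sub>R f x = indicator {a..} x *\<^sub>R f x"
    using AE_lborel_singleton[of a] by (auto split: split_indicator elim!: eventually_mono)
  show "(\<lambda>x. indicator {a<..} x *\<^sub>R f x) \<in> borel_measurable lborel"
    using assms[folded set_integrable_Ioi_iff_Ici] unfolding set_integrable_def by (rule borel_measurable_integrable)
  show "(\<lambda>x. indicator {a..} x *\<^sub>R f x) \<in> borel_measurable lborel"
    using assms unfolding set_integrable_def by (rule borel_measurable_integrable)
qed

lemma macdonald_integrand_measurable:
  "(\<lambda>u. exp (- x * cosh u) * cos (\<tau> * u :: real)) \<in> borel_measurable lborel"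
  unfolding measurable_lborel2
  by (intro borel_measurable_continuous_onI macdonald_integrand_continuous)

lemma macdonald_integrand_integrable:
  assumes "x > 0"
  shows "set_integrable lborel {0..} (\<lambda>u. exp (- x * cosh u) * cos (\<tau> * u :: real))"
proof -
  let ?g = "\<lambda>u. exp (- x * cosh u) * cos (\<tau> * u :: real)"
  have "set_integrable lborel {0<..} ?g"
  proof (rule set_integrable_bound[OF integrable_I0i_exp_mscale[OF assms]])
    show "set_borel_measurable lborel {0<..} ?g"
      unfolding set_borel_measurable_def
      by (intro borel_measurable_scaleR borel_measurable_indicator macdonald_integrand_measurable) simp
    show "AE u in lborel. u \<in> {0<..} \<longrightarrow> norm (?g u) \<le> norm (exp (- (u * x)))"
    proof (intro AE_I2 impI)
      fix u :: real
      have "x * u \<le> x * cosh u" using assms le_cosh_real by (intro mult_left_mono) auto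
      then have "exp (- x * cosh u) * \<bar>cos (\<tau> * u)\<bar> \<le> exp (- (u * x)) * 1"
        by (intro mult_mono) (auto simp: mult.commute)
      then show "norm (?g u) \<le> norm (exp (- (u * x)))" by (simp add: abs_mult)
    qed
  qed
  then show ?thesis by (simp only: set_integrable_Ioi_iff_Ici)
qed

lemma macdonald_im_tendsto:
  assumes "x > 0"
  shows "((\<lambda>R. integral {0..R} (\<lambda>u. exp (- x * cosh u) * cos (\<tau> * u))) \<longlongrightarrow> macdonald_im \<tau> x) at_top"
proof -
  let ?g = "\<lambda>u. exp (- x * cosh u) * cos (\<tau> * u :: real)"
  note I = macdonald_integrand_integrable[OF assms, of \<tau>]
  have "((\<lambda>R. LINT u:{0..R}|lborel. ?g u) \<longlongrightarrow> (LINT u:{0..}|lborel. ?g u)) at_top"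
    by (rule tendsto_set_lebesgue_integral_at_top[OF _ I]) auto
  also have "(LINT u:{0..}|lborel. ?g u) = macdonald_im \<tau> x"
    unfolding macdonald_im_def interval_lebesgue_integral_0_infty
    by (rule set_integral_Ioi_eq_Ici[OF I, symmetric])
  also have "(\<lambda>R. LINT u:{0..R}|lborel. ?g u) = (\<lambda>R. integral {0..R} ?g)"
    by (intro ext set_borel_integral_eq_integral(2) set_integrable_subset[OF I]) auto
  finally show ?thesis .
qed

lemma integral_exp_Icc: "c > 0 \<Longrightarrow> R \<le> S \<Longrightarrow> ((\<lambda>u::real. exp (- c * u)) has_integral ((exp (- c * R) - exp (- c * S)) / c)) {R..S}"
proof -
  assume "c > 0" "R \<le> S"
  have "((\<lambda>u::real. exp (- c * u)) has_integral (- exp (- c * S) / c - - exp (- c * R) / c)) {R..S}"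
    using \<open>c > 0\<close>
    by (intro fundamental_theorem_of_calculus[OF \<open>R \<le> S\<close>])
       (auto intro!: derivative_eq_intros simp: has_real_derivative_iff_has_vector_derivative[symmetric])
  also have "- exp (- c * S) / c - - exp (- c * R) / c = (exp (- c * R) - exp (- c * S)) / c"
    by (simp add: diff_divide_distrib)
  finally show ?thesis .
qed

lemma macdonald_truncation_bound:
  assumes "x > 0" "0 \<le> R"
  shows "\<bar>macdonald_im \<tau> x - integral {0..R} (\<lambda>u. exp (- x * cosh u) * cos (\<tau> * u))\<bar> \<le> exp (- x * R) / x"
proof (rule tendsto_upperbound)
  let ?g = "\<lambda>u. exp (- x * cosh u) * cos (\<tau> * u :: real)"
  show "((\<lambda>S. \<bar>integral {0..S} ?g - integral {0..R} ?g\<bar>) \<longlongrightarrow> \<bar>macdonald_im \<tau> x - integral {0..R} ?g\<bar>) at_top"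
    by (intro tendsto_intros macdonald_im_tendsto assms)
  show "\<forall>\<^sub>F S in at_top. \<bar>integral {0..S} ?g - integral {0..R} ?g\<bar> \<le> exp (- x * R) / x"
    using eventually_ge_at_top[of R]
  proof eventually_elim
    case (elim S)
    have "integral {0..R} ?g + integral {R..S} ?g = integral {0..S} ?g"
      using assms elim by (intro Henstock_Kurzweil_Integration.integral_combine
        integrable_continuous_real macdonald_integrand_continuous)
    moreover have "norm (integral {R..S} ?g) \<le> integral {R..S} (\<lambda>u. exp (- x * u))"
    proof (rule integral_norm_bound_integral)
      show "?g integrable_on {R..S}"
        by (intro integrable_continuous_real macdonald_integrand_continuous)
      show "(\<lambda>u. exp (- x * u)) integrable_on {R..S}"
        using integral_exp_Icc[OF assms(1) elim] by blast
      fix u assume "u \<in> {R..S}"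
      have "x * u \<le> x * cosh u" using assms le_cosh_real by (intro mult_left_mono) auto
      then have "exp (- x * cosh u) * \<bar>cos (\<tau> * u)\<bar> \<le> exp (- x * u) * 1"
        by (intro mult_mono) auto
      then show "norm (?g u) \<le> exp (- x * u)" by (simp add: abs_mult)
    qed
    moreover have "integral {R..S} (\<lambda>u. exp (- x * u)) \<le> exp (- x * R) / x"
      unfolding integral_unique[OF integral_exp_Icc[OF assms(1) elim]]
      using assms by (intro divide_right_mono) auto
    ultimately show ?case unfolding real_norm_def by linarith
  qed
qed auto

lemma macdonald_im_continuous:
  assumes "x > 0"
  shows "continuous_on UNIV (\<lambda>\<tau>. macdonald_im \<tau> x)"
proof (rule uniform_limit_theorem)
  show "\<forall>\<^sub>F R in at_top. continuous_on UNIV (\<lambda>\<tau>. integral {0..R} (\<lambda>u. exp (- x * cosh u) * cos (\<tau> * u)))"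
    unfolding interval_cbox
    by (intro always_eventually allI integral_continuous_on_param)
       (auto intro!: continuous_intros simp: split_beta)
  show "uniform_limit UNIV (\<lambda>R \<tau>. integral {0..R} (\<lambda>u. exp (- x * cosh u) * cos (\<tau> * u)))
     (\<lambda>\<tau>. macdonald_im \<tau> x) at_top"
  proof (rule uniform_limitI)
    fix e :: real assume "e > 0"
    have "((\<lambda>R. exp (- x * R) / x) \<longlongrightarrow> 0) at_top"
      using assms by real_asymp
    then have "\<forall>\<^sub>F R in at_top. exp (- x * R) / x < e"
      using \<open>e > 0\<close> order_tendstoD by blast
    then show "\<forall>\<^sub>F R in at_top. \<forall>\<tau>\<in>UNIV. dist (integral {0..R} (\<lambda>u. exp (- x * cosh u) * cos (\<tau> * u)))
        (macdonald_im \<tau> x) < e"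
      using eventually_ge_at_top[of 0]
    proof eventually_elim
      case (elim R)
      show ?case
        using macdonald_truncation_bound[OF assms elim(2)] elim(1)
        by (auto simp: dist_real_def abs_minus_commute intro: le_less_trans)
    qed
  qed
qed auto

text \<open>
  For \<open>\<beta> < pi / 2\<close> the kernel decays, so its cosine transform is
  \<open>cosh (\<beta> * \<tau>) * macdonald_im \<tau> x\<close>.
\<close>

lemma rotated_kernel_tendsto:
  assumes "x > 0" "0 \<le> \<beta>" "\<beta> < pi / 2"
  shows "((\<lambda>R. integral {0..R} (\<lambda>v. rotated_kernel x \<beta> v * cos (\<tau> * v)))
    \<longlongrightarrow> cosh (\<beta> * \<tau>) * macdonald_im \<tau> x) at_top"
proof -
  let ?A = "\<lambda>R. cosh (\<beta> * \<tau>) * integral {0..R} (\<lambda>v. exp (- x * cosh v) * cos (\<tau> * v))"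
  let ?B = "\<lambda>R. integral {0..R} (\<lambda>v. rotated_kernel x \<beta> v * cos (\<tau> * v))"
  have "x * cos \<beta> > 0" using assms cos_gt_zero_pi by auto
  have decay: "((\<lambda>R. C * exp (- c * R)) \<longlongrightarrow> 0) at_top" if "c > 0" for C c :: real
    using that by real_asymp
  have "((\<lambda>R. \<beta> * exp (2 * \<bar>\<tau>\<bar> * \<beta>) * exp (- (x * cos \<beta>) * R)) \<longlongrightarrow> 0) at_top"
    by (rule decay) fact
  then have "((\<lambda>R. ?A R - ?B R) \<longlongrightarrow> 0) at_top"
  proof (rule Lim_null_comparison[rotated])
    show "\<forall>\<^sub>F R in at_top. norm (?A R - ?B R) \<le> \<beta> * exp (2 * \<bar>\<tau>\<bar> * \<beta>) * exp (- (x * cos \<beta>) * R)"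
      using eventually_ge_at_top[of 0]
    proof eventually_elim
      case (elim R)
      have "\<bar>?A R - ?B R\<bar> \<le> \<beta> * exp (2 * \<bar>\<tau>\<bar> * \<beta>) * exp (- x * cos \<beta> * cosh R)"
        using assms elim by (intro rotated_kernel_integral_bound) auto
      also have "\<dots> \<le> \<beta> * exp (2 * \<bar>\<tau>\<bar> * \<beta>) * exp (- (x * cos \<beta>) * R)"
      proof (intro mult_left_mono)
        have "x * cos \<beta> * R \<le> x * cos \<beta> * cosh R"
          using \<open>x * cos \<beta> > 0\<close> le_cosh_real by (intro mult_left_mono) auto
        then show "exp (- x * cos \<beta> * cosh R) \<le> exp (- (x * cos \<beta>) * R)" by simp
      qed (use assms in auto)
      finally show ?case by simp
    qed
  qed
  moreover have "(?A \<longlongrightarrow> cosh (\<beta> * \<tau>) * macdonald_im \<tau> x) at_top"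
    by (intro tendsto_intros macdonald_im_tendsto assms)
  ultimately have "((\<lambda>R. ?A R - (?A R - ?B R)) \<longlongrightarrow> cosh (\<beta> * \<tau>) * macdonald_im \<tau> x - 0) at_top"
    by (intro tendsto_diff)
  then show ?thesis by simp
qed

lemma rotated_kernel_continuous:
  fixes f g :: "'a::t2_space \<Rightarrow> real"
  shows
  "continuous_on S f \<Longrightarrow> continuous_on S g \<Longrightarrow> continuous_on S (\<lambda>z. rotated_kernel x (f z) (g z))"
  unfolding rotated_kernel_def by (intro continuous_intros)

lemma abs_rotated_kernel_le: "\<bar>rotated_kernel x \<beta> v\<bar> \<le> exp (- x * cos \<beta> * cosh v)"
  unfolding rotated_kernel_def by (simp add: abs_mult mult_left_le)

lemma integral_rotated_kernel_cos_bound: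
  assumes "x > 0" "0 \<le> \<beta>" "\<beta> < pi / 2" "0 \<le> R"
  shows "\<bar>integral {0..R} (\<lambda>v. rotated_kernel x \<beta> v * cos (\<tau> * v))\<bar> \<le> 1 / (x * cos \<beta>)"
proof -
  have c: "x * cos \<beta> > 0" using assms cos_gt_zero_pi by auto
  have "norm (integral {0..R} (\<lambda>v. rotated_kernel x \<beta> v * cos (\<tau> * v))) \<le> integral {0..R} (\<lambda>u. exp (- (x * cos \<beta>) * u))"
  proof (rule integral_norm_bound_integral)
    show "(\<lambda>v. rotated_kernel x \<beta> v * cos (\<tau> * v)) integrable_on {0..R}"
      by (intro integrable_continuous_real continuous_intros rotated_kernel_continuous)
    show "(\<lambda>u. exp (- (x * cos \<beta>) * u)) integrable_on {0..R}"
      using integral_exp_Icc[OF c assms(4)] by blast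
    fix u assume "u \<in> {0..R}"
    have "x * cos \<beta> * u \<le> x * cos \<beta> * cosh u" using c le_cosh_real by (intro mult_left_mono) auto
    then have "\<bar>rotated_kernel x \<beta> u\<bar> \<le> exp (- (x * cos \<beta>) * u)"
      using abs_rotated_kernel_le[of x \<beta> u] by (smt (verit) exp_le_cancel_iff mult_minus_left)
    then have "\<bar>rotated_kernel x \<beta> u\<bar> * \<bar>cos (\<tau> * u)\<bar> \<le> exp (- (x * cos \<beta>) * u) * 1"
      by (intro mult_mono) auto
    then show "norm (rotated_kernel x \<beta> u * cos (\<tau> * u)) \<le> exp (- (x * cos \<beta>) * u)" by (simp add: abs_mult)
  qed
  also have "\<dots> \<le> 1 / (x * cos \<beta>)"
    unfolding integral_unique[OF integral_exp_Icc[OF c assms(4)]]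
    using c by (intro divide_right_mono) auto
  finally show ?thesis by simp
qed

text \<open>
  The decay of the Macdonald function in its order: exponential of every rate \<open>\<beta> < pi / 2\<close>.
\<close>

lemma cosh_macdonald_bound:
  assumes "x > 0" "0 \<le> \<beta>" "\<beta> < pi / 2"
  shows "cosh (\<beta> * \<tau>) * \<bar>macdonald_im \<tau> x\<bar> \<le> 1 / (x * cos \<beta>)"
proof -
  have "\<bar>cosh (\<beta> * \<tau>) * macdonald_im \<tau> x\<bar> \<le> 1 / (x * cos \<beta>)"
  proof (rule tendsto_upperbound)
    show "((\<lambda>R. \<bar>integral {0..R} (\<lambda>v. rotated_kernel x \<beta> v * cos (\<tau> * v))\<bar>)
      \<longlongrightarrow> \<bar>cosh (\<beta> * \<tau>) * macdonald_im \<tau> x\<bar>) at_top"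
      by (intro tendsto_intros rotated_kernel_tendsto assms)
    show "\<forall>\<^sub>F R in at_top. \<bar>integral {0..R} (\<lambda>v. rotated_kernel x \<beta> v * cos (\<tau> * v))\<bar> \<le> 1 / (x * cos \<beta>)"
      using eventually_ge_at_top[of 0] by eventually_elim (intro integral_rotated_kernel_cos_bound assms)
  qed simp
  then show ?thesis by (simp add: abs_mult)
qed

section \<open>Dirichlet kernels and the sine integral\<close>

text \<open>
  The kernel \<open>sin (N * y) / y\<close>, with its continuous value \<open>N\<close> at \<open>y = 0\<close>.
\<close>

definition dirichlet_kernel :: "real \<Rightarrow> real \<Rightarrow> real" where
  "dirichlet_kernel N y = N * sinc (N * y)"

lemma dirichlet_kernel_nonzero: "y \<noteq> 0 \<Longrightarrow> dirichlet_kernel N y = sin (N * y) / y"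
  by (simp add: dirichlet_kernel_def)

lemma continuous_on_dirichlet_kernel [continuous_intros]:
  "continuous_on S f \<Longrightarrow> continuous_on S (\<lambda>z. dirichlet_kernel N (f z))"
  unfolding dirichlet_kernel_def by (intro continuous_intros)

lemma DERIV_Si_dirichlet: "((\<lambda>y. Si (N * y)) has_real_derivative dirichlet_kernel N y) (at y)"
proof -
  have "((\<lambda>y. Si (N * y)) has_real_derivative sinc (N * y) * N) (at y)"
    by (rule DERIV_chain2[where f=Si and g="\<lambda>y. N * y", OF DERIV_Si]) (auto intro!: derivative_eq_intros)
  then show ?thesis by (simp only: dirichlet_kernel_def mult.commute)
qed

lemma integral_cos_Icc:
  assumes "0 \<le> N"
  shows "((\<lambda>\<tau>. cos (\<tau> * y)) has_integral dirichlet_kernel N y) {0..N}"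
proof (cases "y = 0")
  case True
  then show ?thesis using has_integral_const_real[of "1::real" 0 N] assms by (simp add: dirichlet_kernel_def)
next
  case False
  then have "((\<lambda>\<tau>. cos (\<tau> * y)) has_integral (sin (N * y) / y - sin (0 * y) / y)) {0..N}"
    by (intro fundamental_theorem_of_calculus assms)
       (auto intro!: derivative_eq_intros simp: has_real_derivative_iff_has_vector_derivative[symmetric])
  then show ?thesis using False by (simp add: dirichlet_kernel_nonzero)
qed

lemma integral_cos_mult_cos:
  assumes "0 \<le> N"
  shows "integral {0..N} (\<lambda>\<tau>. cos (\<tau> * v) * cos (\<tau> * u))
    = (dirichlet_kernel N (v - u) + dirichlet_kernel N (v + u)) / 2"
proof -
  have "((\<lambda>\<tau>. (cos (\<tau> * (v - u)) + cos (\<tau> * (v + u))) / 2) has_integral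
    (dirichlet_kernel N (v - u) + dirichlet_kernel N (v + u)) / 2) {0..N}"
    by (intro has_integral_divide has_integral_add integral_cos_Icc assms)
  then show ?thesis
    by (intro integral_unique) (simp add: cos_times_cos right_diff_distrib distrib_left)
qed

lemma Si_minus: "Si (- t) = - Si t"
  using Si_neg[of t] Si_neg[of "- t"] by (cases "t \<ge> 0") auto

lemma Si_at_bot: "(Si \<longlongrightarrow> - (pi / 2)) at_bot"
proof -
  have "((\<lambda>t. - Si t) \<longlongrightarrow> - (pi / 2)) at_top" by (intro tendsto_minus Si_at_top)
  then show ?thesis by (simp add: filterlim_at_bot_mirror Si_minus)
qed

lemma Si_scaled_limit:
  assumes "filterlim X at_top F" "y \<noteq> 0"
  shows "((\<lambda>k. Si (X k * y)) \<longlongrightarrow> pi / 2 * sgn y) F"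
proof (cases "y > 0")
  case True
  then have "filterlim (\<lambda>k. y * X k) at_top F"
    by (intro filterlim_tendsto_pos_mult_at_top[OF tendsto_const _ assms(1)])
  from filterlim_compose[OF Si_at_top this] show ?thesis using True by (simp add: mult.commute)
next
  case False
  then have "filterlim (\<lambda>k. y * X k) at_bot F"
    using assms(2) by (intro filterlim_tendsto_neg_mult_at_bot[OF tendsto_const _ assms(1)]) simp
  from filterlim_compose[OF Si_at_bot this] show ?thesis using False assms(2) by (simp add: mult.commute)
qed

lemma local_dirichlet_eq:
  fixes f f' :: "real \<Rightarrow> real"
  assumes "0 \<le> M"
    and f: "\<And>x. (f has_real_derivative f' x) (at x)" and f': "continuous_on {0..M} f'"
  shows "integral {0..M} (\<lambda>v. f v * (dirichlet_kernel N (v - u) + dirichlet_kernel N (v + u)))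
    = f M * (Si (N * (M - u)) + Si (N * (M + u)))
      - integral {0..M} (\<lambda>v. f' v * (Si (N * (v - u)) + Si (N * (v + u))))"
proof -
  have "((\<lambda>v. Si (N * (v + c))) has_real_derivative dirichlet_kernel N (v + c) * 1) (at v)" for v c
    by (rule DERIV_chain2[where f="\<lambda>y. Si (N * y)" and g="\<lambda>v. v + c", OF DERIV_Si_dirichlet])
       (auto intro!: derivative_eq_intros)
  from this[of "- u"] this[of u]
  have "((\<lambda>v. Si (N * (v - u))) has_real_derivative dirichlet_kernel N (v - u)) (at v)"
    "((\<lambda>v. Si (N * (v + u))) has_real_derivative dirichlet_kernel N (v + u)) (at v)" for v
    by simp_all
  then have "((\<lambda>v. Si (N * (v - u)) + Si (N * (v + u))) has_real_derivative
      dirichlet_kernel N (v - u) + dirichlet_kernel N (v + u)) (at v)" for v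
    by (intro DERIV_add)
  then have "integral {0..M} (\<lambda>v. f v * (dirichlet_kernel N (v - u) + dirichlet_kernel N (v + u)))
    = f M * (Si (N * (M - u)) + Si (N * (M + u))) - f 0 * (Si (N * (0 - u)) + Si (N * (0 + u)))
      - integral {0..M} (\<lambda>v. f' v * (Si (N * (v - u)) + Si (N * (v + u))))"
    by (intro integral_by_parts_C1 assms(1) f f') (auto intro!: continuous_intros)
  then show ?thesis by (simp add: Si_minus)
qed

lemma Si_sum_continuous:
  "continuous_on S (\<lambda>v. Si (N * (v - u)) + Si (N * (v + u)))"
  by (intro continuous_intros continuous_on_compose2[OF continuous_at_imp_continuous_on[of UNIV Si]])
     (auto simp: isCont_Si)

lemma local_dirichlet_bounded:
  fixes f f' :: "real \<Rightarrow> real"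
  assumes "0 \<le> M"
    and f: "\<And>x. (f has_real_derivative f' x) (at x)" and f': "continuous_on {0..M} f'"
  shows "\<exists>C. \<forall>N u. \<bar>integral {0..M} (\<lambda>v. f v * (dirichlet_kernel N (v - u) + dirichlet_kernel N (v + u)))\<bar> \<le> C"
proof -
  obtain B where B: "\<bar>Si t\<bar> \<le> B" for t using bounded_Si by auto
  have B2: "\<bar>Si s + Si t\<bar> \<le> 2 * B" for s t using B[of s] B[of t] by linarith
  have "\<bar>integral {0..M} (\<lambda>v. f v * (dirichlet_kernel N (v - u) + dirichlet_kernel N (v + u)))\<bar>
    \<le> \<bar>f M\<bar> * (2 * B) + integral {0..M} (\<lambda>v. \<bar>f' v\<bar> * (2 * B))" for N u
  proof -
    have "norm (integral {0..M} (\<lambda>v. f' v * (Si (N * (v - u)) + Si (N * (v + u)))))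
      \<le> integral {0..M} (\<lambda>v. \<bar>f' v\<bar> * (2 * B))"
    proof (rule integral_norm_bound_integral)
      show "(\<lambda>v. f' v * (Si (N * (v - u)) + Si (N * (v + u)))) integrable_on {0..M}"
        by (intro integrable_continuous_real continuous_on_mult f' Si_sum_continuous)
      show "(\<lambda>v. \<bar>f' v\<bar> * (2 * B)) integrable_on {0..M}"
        by (intro integrable_continuous_real continuous_intros f')
      show "norm (f' v * (Si (N * (v - u)) + Si (N * (v + u)))) \<le> \<bar>f' v\<bar> * (2 * B)" for v
        unfolding real_norm_def abs_mult by (intro mult_left_mono B2) simp
    qed
    moreover have "\<bar>f M * (Si (N * (M - u)) + Si (N * (M + u)))\<bar> \<le> \<bar>f M\<bar> * (2 * B)"
      unfolding abs_mult by (intro mult_left_mono B2) simp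
    ultimately show ?thesis unfolding local_dirichlet_eq[OF assms] real_norm_def by linarith
  qed
  then show ?thesis by blast
qed

text \<open>
  As \<open>X k\<close> tends to infinity, \<open>Si (X k * (v - u))\<close> tends to \<open>pi / 2 * sgn (v - u)\<close> boundedly. A
  single point \<open>v = u\<close> is exceptional, and the functions are set to \<open>0\<close> there.
\<close>

lemma local_dirichlet_limit:
  fixes f f' :: "real \<Rightarrow> real"
  assumes "0 < u" "u < M"
    and f: "\<And>x. (f has_real_derivative f' x) (at x)" and f': "continuous_on {0..M} f'"
    and X: "filterlim X at_top sequentially"
  shows "(\<lambda>k. integral {0..M} (\<lambda>v. f v * (dirichlet_kernel (X k) (v - u) + dirichlet_kernel (X k) (v + u))))
    \<longlonglongrightarrow> pi * f u"
proof -
  obtain B where B: "\<bar>Si t\<bar> \<le> B" for t using bounded_Si by auto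
  have B2: "\<bar>Si s + Si t\<bar> \<le> 2 * B" for s t using B[of s] B[of t] by linarith
  have B0: "0 \<le> B" using B[of 0] by linarith
  define S where "S k v = Si (X k * (v - u)) + Si (X k * (v + u))" for k v
  define g where "g v = (if v = u then 0 else f' v * (pi / 2 * (sgn (v - u) + 1)))" for v
  define q where "q k v = (if v = u then 0 else f' v * S k v)" for k v
  have q: "integral {0..M} (q k) = integral {0..M} (\<lambda>v. f' v * S k v)" for k
    by (rule integral_spike[of "{u}"]) (auto simp: q_def)
  have cint: "(\<lambda>v. f' v * S k v) integrable_on {0..M}" for k
    unfolding S_def by (intro integrable_continuous_real continuous_on_mult f' Si_sum_continuous)
  have "(\<lambda>k. integral {0..M} (q k)) \<longlonglongrightarrow> integral {0..M} g"
  proof (rule dominated_convergence(2))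
    show "q k integrable_on {0..M}" for k
      by (rule integrable_spike[OF cint[of k], of "{u}"]) (auto simp: q_def)
    show "(\<lambda>v. \<bar>f' v\<bar> * (2 * B)) integrable_on {0..M}"
      by (intro integrable_continuous_real continuous_intros f')
    show "norm (q k v) \<le> \<bar>f' v\<bar> * (2 * B)" for k v
    proof -
      have "\<bar>f' v\<bar> * \<bar>S k v\<bar> \<le> \<bar>f' v\<bar> * (2 * B)"
        unfolding S_def by (intro mult_left_mono B2) simp
      then show ?thesis using B0 by (simp add: q_def abs_mult)
    qed
    show "(\<lambda>k. q k v) \<longlonglongrightarrow> g v" if "v \<in> {0..M}" for v
    proof (cases "v = u")
      case False
      have "v + u > 0" using that assms by simp
      then have "(\<lambda>k. f' v * S k v) \<longlonglongrightarrow> f' v * (pi / 2 * sgn (v - u) + pi / 2 * sgn (v + u))"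
        unfolding S_def using False by (intro tendsto_mult tendsto_add tendsto_const Si_scaled_limit X) auto
      moreover have "sgn (v + u) = 1" using \<open>v + u > 0\<close> by simp
      ultimately show ?thesis using False by (simp add: q_def g_def distrib_left)
    qed (simp add: q_def g_def)
  qed
  moreover have "integral {0..M} g = pi * (f M - f u)"
  proof -
    have "(g has_integral 0) {0..u}"
      by (rule has_integral_eq[OF _ has_integral_0]) (auto simp: g_def)
    moreover have "(g has_integral pi * (f M - f u)) {u..M}"
    proof (rule has_integral_spike[of "{u}"])
      show "((\<lambda>v. pi * f' v) has_integral pi * (f M - f u)) {u..M}"
        using assms(2) f by (intro has_integral_mult_right fundamental_theorem_of_calculus)
          (auto simp: has_real_derivative_iff_has_vector_derivative[symmetric] intro: has_field_derivative_at_within)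
    qed (auto simp: g_def)
    ultimately have "(g has_integral 0 + pi * (f M - f u)) {0..M}"
      using assms(1,2) by (intro has_integral_combine[of 0 u M]) auto
    from integral_unique[OF this] show ?thesis by simp
  qed
  moreover have "(\<lambda>k. f M * S k M) \<longlonglongrightarrow> f M * (pi / 2 * sgn (M - u) + pi / 2 * sgn (M + u))"
    unfolding S_def using assms(1,2) by (intro tendsto_mult tendsto_add tendsto_const Si_scaled_limit X) auto
  ultimately have "(\<lambda>k. f M * S k M - integral {0..M} (q k)) \<longlonglongrightarrow>
     f M * (pi / 2 * sgn (M - u) + pi / 2 * sgn (M + u)) - pi * (f M - f u)"
    by (intro tendsto_diff) simp_all
  also have "f M * (pi / 2 * sgn (M - u) + pi / 2 * sgn (M + u)) - pi * (f M - f u) = pi * f u"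
    using assms(1,2) by (simp add: right_diff_distrib mult.commute)
  finally show ?thesis
    using local_dirichlet_eq[of M f f', OF _ f f'] assms(1,2) by (simp add: q S_def)
qed

section \<open>Inversion of the transform of the rotated kernel\<close>

text \<open>The derivative of the rotated kernel in \<open>v\<close>.\<close>

definition rotated_kernel_deriv :: "real \<Rightarrow> real \<Rightarrow> real \<Rightarrow> real" where
  "rotated_kernel_deriv x \<beta> v = - x * cos \<beta> * sinh v * exp (- x * cos \<beta> * cosh v) * cos (x * sin \<beta> * sinh v)
     - exp (- x * cos \<beta> * cosh v) * sin (x * sin \<beta> * sinh v) * (x * sin \<beta> * cosh v)"

lemma DERIV_rotated_kernel: "(rotated_kernel x \<beta> has_real_derivative rotated_kernel_deriv x \<beta> v) (at v)"
  unfolding rotated_kernel_def[abs_def] rotated_kernel_deriv_def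
  by (auto intro!: derivative_eq_intros simp: algebra_simps)

lemma continuous_on_rotated_kernel_deriv: "continuous_on S (rotated_kernel_deriv x \<beta>)"
  unfolding rotated_kernel_deriv_def[abs_def] by (intro continuous_intros)

lemma abs_average_le: "\<bar>a\<bar> \<le> c \<Longrightarrow> \<bar>b\<bar> \<le> c \<Longrightarrow> \<bar>(a + b) / 2\<bar> \<le> (c::real)"
  by (simp add: abs_le_iff)

text \<open>
  The bound does not depend on \<open>N\<close>, nor on \<open>R\<close>, and stays finite as \<open>\<beta>\<close> tends to \<open>pi / 2\<close>, where
  the kernel ceases to be integrable. The factor \<open>exp (- x * cos \<beta> * cosh v) / (v - u)\<close> is a
  decreasing weight with values at most \<open>1\<close>, and the trigonometric factors combine into two
  cosines with the phases \<open>A * sinh v \<plusminus> N * (v - u)\<close>.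
\<close>

lemma rotated_kernel_tail_bound:
  assumes "x > 0" "0 < \<beta>" "\<beta> \<le> pi / 2" "\<bar>u\<bar> \<le> M - 1" "0 < M" "M \<le> R"
  shows "\<bar>integral {M..R} (\<lambda>v. rotated_kernel x \<beta> v * dirichlet_kernel N (v - u))\<bar>
    \<le> 10 / sqrt (x * sin \<beta> * sinh M)"
proof -
  define A where "A = x * sin \<beta>"
  have "sin \<beta> > 0" using assms by (intro sin_gt_zero) auto
  then have "A > 0" using assms by (simp add: A_def)
  have cos0: "cos \<beta> \<ge> 0" using assms by (intro cos_ge_zero) auto
  then have c0: "x * cos \<beta> \<ge> 0" using assms by simp
  define l where "l = A * sinh M"
  have "l > 0" using \<open>A > 0\<close> assms by (simp add: l_def)
  have gap: "v - u \<ge> 1" if "v \<ge> M" for v using that assms by linarith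
  define w where "w v = exp (- x * cos \<beta> * cosh v) / (v - u)" for v
  define w' where "w' v = (- x * cos \<beta> * sinh v * exp (- x * cos \<beta> * cosh v) * (v - u) - exp (- x * cos \<beta> * cosh v)) / (v - u)^2" for v
  define g where "g v = cos (A * sinh v) * sin (N * (v - u))" for v
  have phase: "\<bar>integral {M..t} (\<lambda>v. cos (A * sinh v + n * (v - u) + c))\<bar> \<le> 10 / sqrt l"
    if "M \<le> t" for t n c
  proof (rule abs_integral_cos_le_second_derivative[OF that \<open>l > 0\<close>])
    show "((\<lambda>v. A * sinh v + n * (v - u) + c) has_real_derivative A * cosh v + n) (at v)" for v
      by (auto intro!: derivative_eq_intros)
    show "((\<lambda>v. A * cosh v + n) has_real_derivative A * sinh v) (at v)" for v
      by (auto intro!: derivative_eq_intros)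
    show "l \<le> A * sinh v" if "v \<in> {M..t}" for v
      using that \<open>A > 0\<close> by (simp add: l_def)
  qed (intro continuous_intros)
  have gint: "\<bar>integral {M..t} g\<bar> \<le> 10 / sqrt l" if "M \<le> t" for t
  proof -
    have "integral {M..t} g = integral {M..t} (\<lambda>v. (cos (A * sinh v + N * (v - u) + - pi / 2)
        + cos (A * sinh v + - N * (v - u) + pi / 2)) / 2)"
      by (intro Henstock_Kurzweil_Integration.integral_cong)
         (simp add: g_def cos_add sin_add cos_diff sin_diff)
    also have "\<dots> = (integral {M..t} (\<lambda>v. cos (A * sinh v + N * (v - u) + - pi / 2))
        + integral {M..t} (\<lambda>v. cos (A * sinh v + - N * (v - u) + pi / 2))) / 2"
      by (simp only: integral_divide, subst Henstock_Kurzweil_Integration.integral_add)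
         (auto intro!: integrable_continuous_real continuous_intros)
    finally have eq: "integral {M..t} g = \<dots>" .
    show ?thesis unfolding eq by (intro abs_average_le phase that)
  qed
  have "\<bar>integral {M..R} (\<lambda>v. w v * g v)\<bar> \<le> 10 / sqrt l * w M"
  proof (rule abs_integral_decreasing_mult_le[OF \<open>M \<le> R\<close>])
    show "(w has_real_derivative w' v) (at v)" if "v \<in> {M..R}" for v
      unfolding w_def[abs_def] w'_def using gap[of v] that
      by (auto intro!: derivative_eq_intros simp: power2_eq_square)
    have "v - u \<noteq> 0" if "v \<in> {M..R}" for v using gap[of v] that by auto
    then show "continuous_on {M..R} w'"
      unfolding w'_def[abs_def] by (intro continuous_intros) auto
    show "w' v \<le> 0" if "v \<in> {M..R}" for v
    proof -
      have "0 \<le> x * cos \<beta> * sinh v * exp (- x * cos \<beta> * cosh v) * (v - u)"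
        using assms cos0 gap[of v] that by (intro mult_nonneg_nonneg) auto
      then have "- x * cos \<beta> * sinh v * exp (- x * cos \<beta> * cosh v) * (v - u) - exp (- x * cos \<beta> * cosh v) \<le> 0"
        using exp_gt_zero[of "- x * cos \<beta> * cosh v"] by linarith
      then show ?thesis unfolding w'_def by (intro divide_nonpos_nonneg) auto
    qed
    show "0 \<le> w R" unfolding w_def using gap[of R] assms by (intro divide_nonneg_nonneg) auto
    show "continuous_on UNIV g" unfolding g_def[abs_def] by (intro continuous_intros)
    show "\<bar>integral {M..t} g\<bar> \<le> 10 / sqrt l" if "t \<in> {M..R}" for t using gint that by simp
  qed
  also have "\<dots> \<le> 10 / sqrt l * 1"
  proof (rule mult_left_mono)
    have "exp (- x * cos \<beta> * cosh M) \<le> 1" using c0 by simp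
    then have "exp (- x * cos \<beta> * cosh M) \<le> M - u" using gap[OF order_refl] by (rule order_trans)
    then show "w M \<le> 1" using gap[OF order_refl] by (simp add: w_def divide_le_eq)
  qed (use \<open>l > 0\<close> in auto)
  also have "integral {M..R} (\<lambda>v. w v * g v) = integral {M..R} (\<lambda>v. rotated_kernel x \<beta> v * dirichlet_kernel N (v - u))"
  proof (rule Henstock_Kurzweil_Integration.integral_cong)
    fix v assume "v \<in> {M..R}"
    then have "v - u \<noteq> 0" using gap[of v] by auto
    then show "w v * g v = rotated_kernel x \<beta> v * dirichlet_kernel N (v - u)"
      by (simp add: w_def g_def rotated_kernel_def dirichlet_kernel_nonzero A_def)
  qed
  finally show ?thesis by (simp add: l_def A_def)
qed

text \<open>
  The cosine transform in \<open>\<tau>\<close> of \<open>cosh (\<beta> * \<tau>) * macdonald_im \<tau> x\<close>, cut off at \<open>N\<close>.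
\<close>

definition partial_inverse :: "real \<Rightarrow> real \<Rightarrow> real \<Rightarrow> real \<Rightarrow> real" where
  "partial_inverse x \<beta> N u = integral {0..N} (\<lambda>\<tau>. cosh (\<beta> * \<tau>) * macdonald_im \<tau> x * cos (\<tau> * u))"

text \<open>
  The contribution of \<open>v \<in> {0..M}\<close> to \<open>partial_inverse\<close>, once the order of integration is
  exchanged.
\<close>

definition local_part :: "real \<Rightarrow> real \<Rightarrow> real \<Rightarrow> real \<Rightarrow> real \<Rightarrow> real" where
  "local_part x \<beta> M N u = integral {0..M} (\<lambda>v. rotated_kernel x \<beta> v *
      (dirichlet_kernel N (v - u) + dirichlet_kernel N (v + u))) / 2"

text \<open>
  For \<open>\<beta> < pi / 2\<close> the transform of the kernel over \<open>{0..R}\<close> converges boundedly as \<open>R\<close> tends to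
  infinity, and for finite \<open>R\<close> the integrations may be exchanged.
\<close>

lemma partial_inverse_local_part_aux:
  assumes x: "x > 0" and \<beta>: "0 < \<beta>" "\<beta> < pi / 2" and u: "\<bar>u\<bar> \<le> M - 1" "0 < M" and N: "0 \<le> N"
  shows "\<bar>partial_inverse x \<beta> N u - local_part x \<beta> M N u\<bar> \<le> 10 / sqrt (x * sin \<beta> * sinh M)"
proof (rule tendsto_upperbound)
  define I where "I R \<tau> = integral {0..R} (\<lambda>v. rotated_kernel x \<beta> v * cos (\<tau> * v))" for R \<tau>
  have cI: "continuous_on {0..N} (I R)" for R
    unfolding I_def[abs_def] interval_cbox
    by (intro integral_continuous_on_param)
       (auto intro!: continuous_intros rotated_kernel_continuous simp: split_beta)
  have "(\<lambda>k. integral {0..N} (\<lambda>\<tau>. I (real k) \<tau> * cos (\<tau> * u))) \<longlonglongrightarrow> partial_inverse x \<beta> N u"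
    unfolding partial_inverse_def
  proof (rule dominated_convergence(2))
    show "(\<lambda>\<tau>. I (real k) \<tau> * cos (\<tau> * u)) integrable_on {0..N}" for k
      by (intro integrable_continuous_real continuous_intros cI)
    show "(\<lambda>\<tau>. 1 / (x * cos \<beta>)) integrable_on {0..N}"
      by (intro integrable_continuous_real continuous_intros)
    show "norm (I (real k) \<tau> * cos (\<tau> * u)) \<le> 1 / (x * cos \<beta>)" for k \<tau>
    proof -
      have "\<bar>I (real k) \<tau>\<bar> \<le> 1 / (x * cos \<beta>)"
        unfolding I_def using assms by (intro integral_rotated_kernel_cos_bound) auto
      then show ?thesis
        by (metis abs_cos_le_one abs_ge_zero abs_mult mult_left_le order_trans real_norm_def)
    qed
    show "(\<lambda>k. I (real k) \<tau> * cos (\<tau> * u)) \<longlonglongrightarrow> cosh (\<beta> * \<tau>) * macdonald_im \<tau> x * cos (\<tau> * u)" for \<tau>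
      unfolding I_def using assms
      by (intro tendsto_mult tendsto_const
          filterlim_compose[OF rotated_kernel_tendsto filterlim_real_sequentially]) auto
  qed
  then show "(\<lambda>k. \<bar>integral {0..N} (\<lambda>\<tau>. I (real k) \<tau> * cos (\<tau> * u)) - local_part x \<beta> M N u\<bar>)
     \<longlonglongrightarrow> \<bar>partial_inverse x \<beta> N u - local_part x \<beta> M N u\<bar>"
    by (intro tendsto_intros)
  show "\<forall>\<^sub>F k in sequentially. \<bar>integral {0..N} (\<lambda>\<tau>. I (real k) \<tau> * cos (\<tau> * u)) - local_part x \<beta> M N u\<bar>
     \<le> 10 / sqrt (x * sin \<beta> * sinh M)"
  proof -
    have "\<forall>\<^sub>F k in sequentially. M \<le> real k"
      by (metis eventually_sequentially nat_ceiling_le_eq)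
    then show ?thesis
    proof eventually_elim
      case (elim k)
      define R where "R = real k"
      have R: "M \<le> R" "0 \<le> R" using elim u by (auto simp: R_def)
      let ?K = "\<lambda>v. rotated_kernel x \<beta> v * (dirichlet_kernel N (v - u) + dirichlet_kernel N (v + u))"
      have "integral {0..N} (\<lambda>\<tau>. I R \<tau> * cos (\<tau> * u))
        = integral {0..N} (\<lambda>\<tau>. integral {0..R} (\<lambda>v. rotated_kernel x \<beta> v * (cos (\<tau> * v) * cos (\<tau> * u))))"
        unfolding I_def by (simp flip: integral_mult_left add: mult.assoc)
      also have "\<dots> = integral {0..R} (\<lambda>v. integral {0..N} (\<lambda>\<tau>. rotated_kernel x \<beta> v * (cos (\<tau> * v) * cos (\<tau> * u))))"
        unfolding interval_cbox
        by (rule integral_swap_continuous)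
           (auto intro!: continuous_intros rotated_kernel_continuous simp: split_beta)
      also have "\<dots> = integral {0..R} (\<lambda>v. ?K v / 2)"
        by (simp add: integral_cos_mult_cos[OF N])
      also have "\<dots> = integral {0..R} ?K / 2" by (rule integral_divide)
      also have "integral {0..R} ?K = integral {0..M} ?K + integral {M..R} ?K"
        using R u by (intro Henstock_Kurzweil_Integration.integral_combine[symmetric]
            integrable_continuous_real continuous_intros rotated_kernel_continuous) auto
      also have "integral {M..R} ?K = integral {M..R} (\<lambda>v. rotated_kernel x \<beta> v * dirichlet_kernel N (v - u))
          + integral {M..R} (\<lambda>v. rotated_kernel x \<beta> v * dirichlet_kernel N (v - (- u)))"
        by (subst Henstock_Kurzweil_Integration.integral_add[symmetric])
           (auto intro!: integrable_continuous_real continuous_intros rotated_kernel_continuous simp: distrib_left)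
      finally have eq: "integral {0..N} (\<lambda>\<tau>. I R \<tau> * cos (\<tau> * u)) - local_part x \<beta> M N u
        = (integral {M..R} (\<lambda>v. rotated_kernel x \<beta> v * dirichlet_kernel N (v - u))
          + integral {M..R} (\<lambda>v. rotated_kernel x \<beta> v * dirichlet_kernel N (v - (- u)))) / 2"
        unfolding local_part_def by (simp only: add_divide_distrib)
      show ?case
        unfolding R_def[symmetric] eq
        by (intro abs_average_le rotated_kernel_tail_bound) (use assms R in auto)
    qed
  qed
qed auto

text \<open>
  The bound of the tail is uniform near \<open>\<beta> = pi / 2\<close>, hence it passes to the limit.
\<close>

lemma partial_inverse_local_part:
  assumes x: "x > 0" and \<beta>: "0 < \<beta>" "\<beta> \<le> pi / 2" and u: "\<bar>u\<bar> \<le> M - 1" "0 < M" and N: "0 \<le> N"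
  shows "\<bar>partial_inverse x \<beta> N u - local_part x \<beta> M N u\<bar> \<le> 10 / sqrt (x * sin \<beta> * sinh M)"
proof (cases "\<beta> < pi / 2")
  case True
  then show ?thesis using partial_inverse_local_part_aux assms by blast
next
  case False
  then have \<beta>_eq: "\<beta> = pi / 2" using \<beta> by simp
  have c1: "continuous_on UNIV (\<lambda>b. partial_inverse x b N u)"
    unfolding partial_inverse_def[abs_def] interval_cbox
    by (intro integral_continuous_on_param)
       (auto intro!: continuous_intros continuous_on_compose2[OF macdonald_im_continuous[OF x]] simp: split_beta)
  have c2: "continuous_on UNIV (\<lambda>b. local_part x b M N u)"
    unfolding local_part_def[abs_def] interval_cbox divide_inverse
    by (intro continuous_on_mult integral_continuous_on_param continuous_on_const)
       (auto intro!: continuous_intros rotated_kernel_continuous simp: split_beta)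
  show ?thesis unfolding \<beta>_eq
  proof (rule tendsto_le[of "at_left (pi / 2)"])
    have "((\<lambda>b. partial_inverse x b N u) \<longlongrightarrow> partial_inverse x (pi/2) N u) (at (pi/2))"
      "((\<lambda>b. local_part x b M N u) \<longlongrightarrow> local_part x (pi/2) M N u) (at (pi/2))"
      using c1 c2 by (auto simp: continuous_on_def)
    then show "((\<lambda>b. \<bar>partial_inverse x b N u - local_part x b M N u\<bar>)
      \<longlongrightarrow> \<bar>partial_inverse x (pi/2) N u - local_part x (pi/2) M N u\<bar>) (at_left (pi/2))"
      by (intro tendsto_intros filterlim_at_split[THEN iffD1, THEN conjunct1]) 
    have "x * sin (pi / 2) * sinh M > 0" using x u by simp
    then show "((\<lambda>b. 10 / sqrt (x * sin b * sinh M)) \<longlongrightarrow> 10 / sqrt (x * sin (pi / 2) * sinh M)) (at_left (pi / 2))"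
      by (intro tendsto_intros) auto
    have "\<forall>\<^sub>F b in at_left (pi / 2). 0 < b \<and> b < pi / 2"
      using eventually_at_left_real[of 0 "pi / 2"] by (auto elim!: eventually_mono)
    then show "\<forall>\<^sub>F b in at_left (pi / 2). \<bar>partial_inverse x b N u - local_part x b M N u\<bar> \<le> 10 / sqrt (x * sin b * sinh M)"
      by eventually_elim (intro partial_inverse_local_part_aux assms; simp)
  qed simp
qed

lemma partial_inverse_bounded:
  assumes x: "x > 0" and \<beta>: "0 < \<beta>" "\<beta> \<le> pi / 2"
  shows "\<exists>C. \<forall>N\<ge>0. \<forall>u\<in>{0..L}. \<bar>partial_inverse x \<beta> N u\<bar> \<le> C"
proof (cases "L \<ge> 0")
  case True
  define M where "M = L + 1"
  have "\<exists>C. \<forall>N u. \<bar>integral {0..M} (\<lambda>v. rotated_kernel x \<beta> v *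
      (dirichlet_kernel N (v - u) + dirichlet_kernel N (v + u)))\<bar> \<le> C"
    by (rule local_dirichlet_bounded[OF _ DERIV_rotated_kernel continuous_on_rotated_kernel_deriv])
       (use True in \<open>simp add: M_def\<close>)
  then obtain C where C: "\<bar>integral {0..M} (\<lambda>v. rotated_kernel x \<beta> v *
      (dirichlet_kernel N (v - u) + dirichlet_kernel N (v + u)))\<bar> \<le> C" for N u
    by blast
  have "\<bar>partial_inverse x \<beta> N u\<bar> \<le> C / 2 + 10 / sqrt (x * sin \<beta> * sinh M)" if "N \<ge> 0" "u \<in> {0..L}" for N u
  proof -
    have "\<bar>partial_inverse x \<beta> N u - local_part x \<beta> M N u\<bar> \<le> 10 / sqrt (x * sin \<beta> * sinh M)"
      using that True by (intro partial_inverse_local_part assms) (auto simp: M_def)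
    moreover have "\<bar>local_part x \<beta> M N u\<bar> \<le> C / 2"
      unfolding local_part_def using C[of N u] by linarith
    ultimately show ?thesis by linarith
  qed
  then show ?thesis by blast
qed auto

text \<open>
  \<open>M\<close> is chosen such that the tail is small for every \<open>N\<close>; then \<open>N\<close> tends to infinity in the
  local part.
\<close>

lemma partial_inverse_limit:
  assumes x: "x > 0" and \<beta>: "0 < \<beta>" "\<beta> \<le> pi / 2" and u: "0 < u"
    and X: "filterlim X at_top sequentially"
  shows "(\<lambda>k. partial_inverse x \<beta> (X k) u) \<longlonglongrightarrow> pi / 2 * rotated_kernel x \<beta> u"
proof (rule tendstoI)
  fix e :: real assume "e > 0"
  have "sin \<beta> > 0" using \<beta> by (intro sin_gt_zero) auto
  then have "x * sin \<beta> > 0" using x by simp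
  moreover have "((\<lambda>M. 10 / sqrt (c * sinh M)) \<longlongrightarrow> 0) at_top" if "c > 0" for c :: real
    using that unfolding sinh_field_def by real_asymp
  ultimately have "\<forall>\<^sub>F M in at_top. 10 / sqrt (x * sin \<beta> * sinh M) < e / 2"
    using \<open>e > 0\<close> by (intro order_tendstoD(2)) auto
  then have "\<forall>\<^sub>F M in at_top. 10 / sqrt (x * sin \<beta> * sinh M) < e / 2 \<and> M \<ge> u + 1"
    using eventually_ge_at_top eventually_conj by blast
  then obtain M where M: "10 / sqrt (x * sin \<beta> * sinh M) < e / 2" "M \<ge> u + 1"
    using eventually_happens trivial_limit_at_top_linorder by blast
  have "(\<lambda>k. local_part x \<beta> M (X k) u) \<longlonglongrightarrow> pi * rotated_kernel x \<beta> u / 2"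
    unfolding local_part_def using u M X
    by (intro tendsto_divide local_dirichlet_limit[OF _ _ DERIV_rotated_kernel continuous_on_rotated_kernel_deriv]) auto
  then have "\<forall>\<^sub>F k in sequentially. dist (local_part x \<beta> M (X k) u) (pi * rotated_kernel x \<beta> u / 2) < e / 2"
    using \<open>e > 0\<close> by (intro tendstoD) auto
  moreover have "\<forall>\<^sub>F k in sequentially. X k \<ge> 0"
    using X by (simp add: filterlim_at_top)
  ultimately show "\<forall>\<^sub>F k in sequentially. dist (partial_inverse x \<beta> (X k) u) (pi / 2 * rotated_kernel x \<beta> u) < e"
  proof eventually_elim
    case (elim k)
    have "\<bar>partial_inverse x \<beta> (X k) u - local_part x \<beta> M (X k) u\<bar> \<le> 10 / sqrt (x * sin \<beta> * sinh M)"
      using elim u M by (intro partial_inverse_local_part assms) auto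
    moreover have "pi / 2 * rotated_kernel x \<beta> u = pi * rotated_kernel x \<beta> u / 2" by simp
    ultimately show ?case using elim(1) M unfolding dist_real_def by linarith
  qed
qed

section \<open>The Parseval identity\<close>

text \<open>The cosine transform at \<open>\<tau>\<close> of a function supported in \<open>{0..L}\<close>.\<close>

definition cosine_transform :: "real \<Rightarrow> (real \<Rightarrow> complex) \<Rightarrow> real \<Rightarrow> complex" where
  "cosine_transform L \<gamma> \<tau> = integral {0..L} (\<lambda>u. \<gamma> u * of_real (cos (\<tau> * u)))"

lemma cosine_transform_continuous:
  assumes "continuous_on {0..L} \<gamma>"
  shows "continuous_on S (cosine_transform L \<gamma>)"
  unfolding cosine_transform_def[abs_def] interval_cbox
  by (intro integral_continuous_on_param)
     (auto intro!: continuous_intros continuous_on_compose2[OF assms] simp: split_beta)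

text \<open>
  Only \<open>\<gamma>\<close> is required to be continuous, without any decay of its transform: the order of
  integration is exchanged on \<open>{0..N} \<times> {0..L}\<close>, and the partial inverses converge boundedly on
  \<open>{0<..L}\<close>.
\<close>

lemma cosine_transform_parseval:
  assumes x: "x > 0" and \<beta>: "0 < \<beta>" "\<beta> \<le> pi / 2" and \<gamma>: "continuous_on {0..L} \<gamma>" and "0 \<le> L"
  shows "((\<lambda>N. integral {0..N} (\<lambda>\<tau>. of_real (cosh (\<beta> * \<tau>) * macdonald_im \<tau> x) * cosine_transform L \<gamma> \<tau>))
    \<longlongrightarrow> of_real (pi / 2) * integral {0..L} (\<lambda>u. \<gamma> u * of_real (rotated_kernel x \<beta> u))) at_top"
proof (rule tendsto_at_topI_sequentially)
  fix X :: "nat \<Rightarrow> real" assume X: "filterlim X at_top sequentially"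
  have mc: "continuous_on S (\<lambda>z. macdonald_im (f z) x)" if "continuous_on S f" for S and f :: "'z::topological_space \<Rightarrow> real"
    using continuous_on_compose2[OF macdonald_im_continuous[OF x] that] by auto
  have swap: "integral {0..N} (\<lambda>\<tau>. of_real (cosh (\<beta> * \<tau>) * macdonald_im \<tau> x) * cosine_transform L \<gamma> \<tau>)
    = integral {0..L} (\<lambda>u. \<gamma> u * of_real (partial_inverse x \<beta> N u))" for N
  proof -
    have "integral {0..N} (\<lambda>\<tau>. of_real (cosh (\<beta> * \<tau>) * macdonald_im \<tau> x) * cosine_transform L \<gamma> \<tau>)
      = integral {0..N} (\<lambda>\<tau>. integral {0..L} (\<lambda>u. \<gamma> u * of_real (cosh (\<beta> * \<tau>) * macdonald_im \<tau> x * cos (\<tau> * u))))"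
      unfolding cosine_transform_def by (simp flip: integral_mult_right add: mult_ac)
    also have "\<dots> = integral {0..L} (\<lambda>u. integral {0..N} (\<lambda>\<tau>. \<gamma> u * of_real (cosh (\<beta> * \<tau>) * macdonald_im \<tau> x * cos (\<tau> * u))))"
      unfolding interval_cbox
      by (rule integral_swap_continuous)
         (auto intro!: continuous_intros mc continuous_on_compose2[OF \<gamma>] simp: split_beta)
    also have "\<dots> = integral {0..L} (\<lambda>u. \<gamma> u * of_real (partial_inverse x \<beta> N u))"
    proof (rule Henstock_Kurzweil_Integration.integral_cong)
      fix u
      have "integral {0..N} (\<lambda>\<tau>. complex_of_real (cosh (\<beta> * \<tau>) * macdonald_im \<tau> x * cos (\<tau> * u)))
        = of_real (partial_inverse x \<beta> N u)"
        unfolding partial_inverse_def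
        by (rule integral_unique, rule has_integral_of_real, rule integrable_integral)
           (intro integrable_continuous_real continuous_intros mc)
      then show "integral {0..N} (\<lambda>\<tau>. \<gamma> u * of_real (cosh (\<beta> * \<tau>) * macdonald_im \<tau> x * cos (\<tau> * u)))
        = \<gamma> u * of_real (partial_inverse x \<beta> N u)"
        by (simp only: integral_mult_right)
    qed
    finally show ?thesis .
  qed
  obtain C where C: "\<bar>partial_inverse x \<beta> N u\<bar> \<le> C" if "N \<ge> 0" "u \<in> {0..L}" for N u
    using partial_inverse_bounded[OF x \<beta>, of L] by blast
  \<comment> \<open>The bound on the partial inverses is available for nonnegative \<open>N\<close> only.\<close>
  define Y where "Y k = max 0 (X k)" for k
  have Y: "filterlim Y at_top sequentially"
    by (rule filterlim_at_top_mono[OF X]) (auto simp: Y_def)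
  define g where "g u = (if u = 0 then 0 else \<gamma> u * of_real (pi / 2 * rotated_kernel x \<beta> u))" for u
  define q where "q k u = (if u = 0 then 0 else \<gamma> u * of_real (partial_inverse x \<beta> (Y k) u))" for k u
  have cp: "continuous_on S (partial_inverse x \<beta> N)" for S N
    unfolding partial_inverse_def[abs_def] interval_cbox
    by (intro integral_continuous_on_param)
       (auto intro!: continuous_intros mc simp: split_beta)
  have cint: "(\<lambda>u. \<gamma> u * of_real (partial_inverse x \<beta> N u)) integrable_on {0..L}" for N
    by (intro integrable_continuous_real continuous_intros \<gamma> cp)
  have "(\<lambda>k. integral {0..L} (q k)) \<longlonglongrightarrow> integral {0..L} g"
  proof (rule dominated_convergence(2))
    show "q k integrable_on {0..L}" for k
      by (rule integrable_spike[OF cint[of "Y k"], of "{0}"]) (auto simp: q_def)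
    show "(\<lambda>u. norm (\<gamma> u) * C) integrable_on {0..L}"
      by (intro integrable_continuous_real continuous_intros \<gamma>)
    show "norm (q k u) \<le> norm (\<gamma> u) * C" if "u \<in> {0..L}" for k u
    proof -
      have C': "\<bar>partial_inverse x \<beta> (Y k) u\<bar> \<le> C" using that by (intro C) (auto simp: Y_def)
      then have "norm (\<gamma> u) * \<bar>partial_inverse x \<beta> (Y k) u\<bar> \<le> norm (\<gamma> u) * C"
        by (intro mult_left_mono) auto
      moreover have "0 \<le> C" using C' by linarith
      ultimately show ?thesis by (simp add: q_def norm_mult)
    qed
    show "(\<lambda>k. q k u) \<longlonglongrightarrow> g u" if "u \<in> {0..L}" for u
    proof (cases "u = 0")
      case False
      then have "(\<lambda>k. partial_inverse x \<beta> (Y k) u) \<longlonglongrightarrow> pi / 2 * rotated_kernel x \<beta> u"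
        using that by (intro partial_inverse_limit assms Y) auto
      then show ?thesis unfolding q_def g_def using False
        by (simp only: if_False) (intro tendsto_mult tendsto_const tendsto_of_real)
    qed (simp add: q_def g_def)
  qed
  moreover have "integral {0..L} (q k) = integral {0..L} (\<lambda>u. \<gamma> u * of_real (partial_inverse x \<beta> (Y k) u))" for k
    by (rule integral_spike[of "{0}"]) (auto simp: q_def)
  moreover have "integral {0..L} g = integral {0..L} (\<lambda>u. of_real (pi / 2) * (\<gamma> u * of_real (rotated_kernel x \<beta> u)))"
    by (rule integral_spike[of "{0}"]) (auto simp: g_def)
  ultimately have "(\<lambda>k. integral {0..L} (\<lambda>u. \<gamma> u * of_real (partial_inverse x \<beta> (Y k) u))) \<longlonglongrightarrow>
     of_real (pi / 2) * integral {0..L} (\<lambda>u. \<gamma> u * of_real (rotated_kernel x \<beta> u))"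
    by (simp only: integral_mult_right)
  moreover have "\<forall>\<^sub>F k in sequentially. Y k = X k"
  proof -
    have "\<forall>\<^sub>F k in sequentially. X k \<ge> 0" using X by (simp add: filterlim_at_top)
    then show ?thesis by eventually_elim (simp add: Y_def)
  qed
  ultimately show "(\<lambda>k. integral {0..X k} (\<lambda>\<tau>. of_real (cosh (\<beta> * \<tau>) * macdonald_im \<tau> x) * cosine_transform L \<gamma> \<tau>))
    \<longlonglongrightarrow> of_real (pi / 2) * integral {0..L} (\<lambda>u. \<gamma> u * of_real (rotated_kernel x \<beta> u))"
    unfolding swap by (elim Lim_transform_eventually) (auto elim: eventually_mono)
qed

section \<open>The orthogonal system on the interval from 0 to arsinh pi\<close>

lemma sin_nat_pi: "sin (real n * pi) = 0" by (simp add: sin_times_pi_eq_0)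

lemma arsinh_pi_nonneg: "0 \<le> arsinh pi" using pi_gt_zero arsinh_real_pos_iff less_imp_le by blast

text \<open>
  The derivative of \<open>sin (n * sinh u)\<close> in \<open>u\<close>.
\<close>

definition sinh_mode :: "nat \<Rightarrow> real \<Rightarrow> real" where
  "sinh_mode n u = real n * cosh u * cos (real n * sinh u)"

lemma sinh_mode_continuous [continuous_intros]:
  fixes g :: "'a::t2_space \<Rightarrow> real"
  shows "continuous_on S g \<Longrightarrow> continuous_on S (\<lambda>z. sinh_mode n (g z))"
  unfolding sinh_mode_def by (intro continuous_intros)

lemma abs_sinh_mode_le:
  assumes "u \<in> {0..l}"
  shows "\<bar>sinh_mode n u\<bar> \<le> real n * cosh l"
proof -
  have "\<bar>sinh_mode n u\<bar> = real n * cosh u * \<bar>cos (real n * sinh u)\<bar>"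
    by (simp add: sinh_mode_def abs_mult)
  also have "\<dots> \<le> real n * cosh u * 1" by (intro mult_left_mono) auto
  also have "\<dots> \<le> real n * cosh l" using assms
    unfolding mult_1_right by (intro mult_left_mono) (auto simp: cosh_real_nonneg_le_iff)
  finally show ?thesis .
qed

lemma sinh_mode_orthogonal:
  assumes "m \<ge> 1" "n \<ge> 1"
  shows "((\<lambda>u. sinh_mode m u * cos (real n * sinh u)) has_integral (if m = n then real n * pi / 2 else 0)) {0..arsinh pi}"
proof (cases "m = n")
  case True
  define G where "G u = real n * (sinh u + sin (2 * real n * sinh u) / (2 * real n)) / 2" for u
  have "((\<lambda>u. sinh_mode m u * cos (real n * sinh u)) has_integral (G (arsinh pi) - G 0)) {0..arsinh pi}"
  proof (rule fundamental_theorem_of_calculus)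
    fix u :: real
    have "(G has_real_derivative real n * (cosh u + cos (2 * real n * sinh u) * (2 * real n * cosh u) / (2 * real n)) / 2) (at u)"
      unfolding G_def[abs_def] by (auto intro!: derivative_eq_intros)
    also have "real n * (cosh u + cos (2 * real n * sinh u) * (2 * real n * cosh u) / (2 * real n)) / 2
      = real n * (cosh u + cos (2 * (real n * sinh u)) * cosh u) / 2"
      using assms by (simp add: mult.assoc)
    also have "\<dots> = sinh_mode m u * cos (real n * sinh u)"
      unfolding cos_double_cos sinh_mode_def using True by (simp add: power2_eq_square algebra_simps)
    finally show "(G has_vector_derivative sinh_mode m u * cos (real n * sinh u)) (at u within {0..arsinh pi})"
      by (auto simp: has_real_derivative_iff_has_vector_derivative[symmetric] intro: has_field_derivative_at_within)
  qed (rule arsinh_pi_nonneg)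
  moreover have "sin (2 * real n * pi) = 0" using sin_nat_pi[of "2 * n"] by simp
  ultimately show ?thesis using True by (simp add: G_def)
next
  case False
  define d where "d = real m - real n"
  define e where "e = real m + real n"
  have nz: "d \<noteq> 0" "e \<noteq> 0" using False assms by (simp_all add: d_def e_def)
  define G where "G u = real m * (sin (d * sinh u) / d + sin (e * sinh u) / e) / 2" for u
  have "((\<lambda>u. sinh_mode m u * cos (real n * sinh u)) has_integral (G (arsinh pi) - G 0)) {0..arsinh pi}"
  proof (rule fundamental_theorem_of_calculus)
    fix u :: real
    have "(G has_real_derivative real m * (cos (d * sinh u) * (d * cosh u) / d
        + cos (e * sinh u) * (e * cosh u) / e) / 2) (at u)"
      unfolding G_def[abs_def] using nz by (auto intro!: derivative_eq_intros)
    also have "real m * (cos (d * sinh u) * (d * cosh u) / d + cos (e * sinh u) * (e * cosh u) / e) / 2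
      = real m * cosh u * ((cos (d * sinh u) + cos (e * sinh u)) / 2)"
      using nz by (simp add: algebra_simps)
    also have "\<dots> = sinh_mode m u * cos (real n * sinh u)"
      by (simp add: sinh_mode_def cos_diff cos_add d_def e_def left_diff_distrib distrib_right)
    finally show "(G has_vector_derivative sinh_mode m u * cos (real n * sinh u)) (at u within {0..arsinh pi})"
      by (auto simp: has_real_derivative_iff_has_vector_derivative[symmetric] intro: has_field_derivative_at_within)
  qed (rule arsinh_pi_nonneg)
  moreover have "sin (d * pi) = 0" "sin (e * pi) = 0"
    by (auto simp: sin_times_pi_eq_0 d_def e_def)
  ultimately show ?thesis using False by (simp add: G_def)
qed

text \<open>
  Integration by parts; the boundary terms vanish because \<open>sinh (arsinh pi) = pi\<close>.
\<close>

lemma sinh_mode_cos_eq: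
  "((\<lambda>u. \<tau> * (sin (real n * sinh u) * sin (\<tau> * u))) has_integral
     integral {0..arsinh pi} (\<lambda>u. sinh_mode n u * cos (\<tau> * u))) {0..arsinh pi}"
proof -
  let ?G = "\<lambda>u. - (sin (real n * sinh u) * cos (\<tau> * u))"
  have "((\<lambda>u. \<tau> * (sin (real n * sinh u) * sin (\<tau> * u)) - sinh_mode n u * cos (\<tau> * u))
      has_integral (?G (arsinh pi) - ?G 0)) {0..arsinh pi}"
  proof (rule fundamental_theorem_of_calculus)
    fix u :: real
    show "(?G has_vector_derivative \<tau> * (sin (real n * sinh u) * sin (\<tau> * u)) - sinh_mode n u * cos (\<tau> * u)) (at u within {0..arsinh pi})"
      unfolding has_real_derivative_iff_has_vector_derivative[symmetric] sinh_mode_def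
      by (auto intro!: derivative_eq_intros simp: algebra_simps)
  qed (rule arsinh_pi_nonneg)
  moreover have "?G (arsinh pi) - ?G 0 = 0" by (simp add: sin_nat_pi)
  moreover have "((\<lambda>u. sinh_mode n u * cos (\<tau> * u)) has_integral integral {0..arsinh pi} (\<lambda>u. sinh_mode n u * cos (\<tau> * u))) {0..arsinh pi}"
    by (intro integrable_integral integrable_continuous_real continuous_intros)
  ultimately have "((\<lambda>u. (\<tau> * (sin (real n * sinh u) * sin (\<tau> * u)) - sinh_mode n u * cos (\<tau> * u)) + sinh_mode n u * cos (\<tau> * u))
    has_integral 0 + integral {0..arsinh pi} (\<lambda>u. sinh_mode n u * cos (\<tau> * u))) {0..arsinh pi}"
    by (intro has_integral_add) simp_all
  then show ?thesis by simp
qed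

lemma interval_integral_of_continuous:
  fixes g G :: "real \<Rightarrow> 'a::euclidean_space"
  assumes "0 \<le> N" and G: "continuous_on {0..N} G" and eq: "\<And>t. 0 < t \<Longrightarrow> t < N \<Longrightarrow> g t = G t"
  shows "interval_lebesgue_integrable lborel 0 (ereal N) g"
    and "(LBINT t=0..ereal N. g t) = integral {0..N} G"
proof -
  have einterval: "einterval 0 (ereal N) = {0<..<N}" by (auto simp: einterval_def zero_ereal_def)
  have le: "(0::ereal) \<le> ereal N" using assms(1) by (simp add: zero_ereal_def)
  have G': "set_integrable lborel {0..N} G"
    unfolding set_integrable_def by (rule borel_integrable_compact) (use G in auto)
  then have "set_integrable lborel {0<..<N} G" by (rule set_integrable_subset) auto
  then have "set_integrable lborel {0<..<N} g"
    using eq set_integrable_cong[of lborel lborel "{0<..<N}" "{0<..<N}" g G] by auto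
  then show "interval_lebesgue_integrable lborel 0 (ereal N) g"
    using le by (simp add: interval_lebesgue_integrable_def einterval)
  have "(LBINT t=0..ereal N. g t) = (LBINT t=0..ereal N. G t)"
    by (rule interval_integral_cong) (use le eq in \<open>auto simp: einterval\<close>)
  also have "\<dots> = integral {0..N} G"
    using interval_integral_eq_integral[OF assms(1) G'] by (simp add: zero_ereal_def)
  finally show "(LBINT t=0..ereal N. g t) = integral {0..N} G" .
qed

section \<open>Series of the functions Ks\<close>

lemma Ks_eq:
  "Ks (real n) (\<i> * of_real \<tau>) (arsinh pi) =
    of_real (1 / sinh (pi * \<tau> / 2) * integral {0..arsinh pi} (\<lambda>u. sin (real n * sinh u) * sin (\<tau> * u)))"
  unfolding Ks_imaginary_order
  by (subst interval_integral_of_continuous(2)) (use arsinh_pi_nonneg in \<open>auto intro!: continuous_intros\<close>)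

lemma integral_complex_of_real:
  fixes f :: "real \<Rightarrow> real"
  shows "continuous_on {a..b} f \<Longrightarrow> integral {a..b} (\<lambda>u. complex_of_real (f u)) = of_real (integral {a..b} f)"
  by (rule integral_unique, rule has_integral_of_real, rule integrable_integral, rule integrable_continuous_real, assumption)

lemma Ks_cosine_transform:
  assumes "\<tau> > 0"
  shows "of_real (\<tau> * sinh (pi * \<tau> / 2)) * Ks (real n) (\<i> * of_real \<tau>) (arsinh pi)
    = cosine_transform (arsinh pi) (\<lambda>u. of_real (sinh_mode n u)) \<tau>"
proof -
  have "sinh (pi * \<tau> / 2) \<noteq> 0" using assms by simp
  then have "of_real (\<tau> * sinh (pi * \<tau> / 2)) * Ks (real n) (\<i> * of_real \<tau>) (arsinh pi)
    = of_real (\<tau> * integral {0..arsinh pi} (\<lambda>u. sin (real n * sinh u) * sin (\<tau> * u)))"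
    unfolding Ks_eq of_real_mult[symmetric] by (intro arg_cong[where f=of_real]) simp
  also have "\<tau> * integral {0..arsinh pi} (\<lambda>u. sin (real n * sinh u) * sin (\<tau> * u))
    = integral {0..arsinh pi} (\<lambda>u. sinh_mode n u * cos (\<tau> * u))"
    using integral_unique[OF sinh_mode_cos_eq[of \<tau> n]] by simp
  also have "of_real \<dots> = cosine_transform (arsinh pi) (\<lambda>u. of_real (sinh_mode n u)) \<tau>"
    unfolding cosine_transform_def of_real_mult[symmetric]
    by (rule integral_complex_of_real[symmetric]) (intro continuous_intros)
  finally show ?thesis .
qed

lemma norm_Ks_le:
  assumes "\<tau> > 0"
  shows "norm (Ks (real n) (\<i> * of_real \<tau>) (arsinh pi)) \<le> arsinh pi / sinh (pi * \<tau> / 2)"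
proof -
  have "norm (integral {0..arsinh pi} (\<lambda>u. sin (real n * sinh u) * sin (\<tau> * u))) \<le> 1 * (arsinh pi - 0)"
    by (rule integral_bound) (use arsinh_pi_nonneg in \<open>auto intro!: continuous_intros simp: abs_mult mult_le_one\<close>)
  then show ?thesis unfolding Ks_eq norm_of_real abs_mult using assms
    by (simp add: divide_right_mono)
qed

lemma integral_suminf_uniform:
  fixes g :: "nat \<Rightarrow> real \<Rightarrow> complex"
  assumes g: "\<And>m. continuous_on {a..b} (g m)"
    and B: "\<And>m u. u \<in> {a..b} \<Longrightarrow> norm (g m u) \<le> B m" "summable B"
  shows "continuous_on {a..b} (\<lambda>u. \<Sum>m. g m u)"
    and "(\<lambda>m. integral {a..b} (g m)) sums integral {a..b} (\<lambda>u. \<Sum>m. g m u)"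
proof -
  have U: "uniform_limit {a..b} (\<lambda>n u. \<Sum>m<n. g m u) (\<lambda>u. \<Sum>m. g m u) sequentially"
    by (rule Weierstrass_m_test[OF B])
  have cs: "continuous_on {a..b} (\<lambda>u. \<Sum>m<n. g m u)" for n
    by (intro continuous_intros g)
  show "continuous_on {a..b} (\<lambda>u. \<Sum>m. g m u)"
    by (rule uniform_limit_theorem[OF _ U]) (auto intro: cs always_eventually)
  obtain I J where I: "\<And>n. ((\<lambda>u. \<Sum>m<n. g m u) has_integral I n) {a..b}"
    and J: "((\<lambda>u. \<Sum>m. g m u) has_integral J) {a..b}" and lim: "I \<longlonglongrightarrow> J"
    using uniform_limit_integral[OF U cs] by auto
  have "I n = (\<Sum>m<n. integral {a..b} (g m))" for n
    using integral_unique[OF I[of n]] by (simp add: integral_sum integrable_continuous_real g)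
  then have "I = (\<lambda>n. \<Sum>m<n. integral {a..b} (g m))" by (rule ext)
  then show "(\<lambda>m. integral {a..b} (g m)) sums integral {a..b} (\<lambda>u. \<Sum>m. g m u)"
    using lim integral_unique[OF J] by (simp add: sums_def)
qed

lemma rotated_kernel_half_pi: "rotated_kernel x (pi / 2) u = cos (x * sinh u)"
  by (simp add: rotated_kernel_def)

lemma macdonald_eq: "macdonald (\<i> * of_real \<tau>) x = of_real (macdonald_im \<tau> x)"
  by (simp add: macdonald_imaginary_order macdonald_im_def)

lemma integral_sinh_mode_cos:
  assumes "m \<ge> 1" "n \<ge> 1"
  shows "integral {0..arsinh pi} (\<lambda>u. complex_of_real (sinh_mode m u * cos (real n * sinh u)))
     = (if m = n then of_real (real n * pi / 2) else 0)"
proof -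
  have "integral {0..arsinh pi} (\<lambda>u. complex_of_real (sinh_mode m u * cos (real n * sinh u)))
    = of_real (integral {0..arsinh pi} (\<lambda>u. sinh_mode m u * cos (real n * sinh u)))"
    by (rule integral_complex_of_real) (intro continuous_intros)
  also have "integral {0..arsinh pi} (\<lambda>u. sinh_mode m u * cos (real n * sinh u)) = (if m = n then real n * pi / 2 else 0)"
    by (rule integral_unique[OF sinh_mode_orthogonal[OF assms]])
  finally show ?thesis by simp
qed

text \<open>
  The series of the modes \<open>sinh_mode m\<close> with the coefficients \<open>a m\<close> converges uniformly to a
  continuous function \<open>\<gamma>\<close> whose cosine transform is \<open>f\<close>. By the Parseval identity at
  \<open>\<beta> = pi / 2\<close> and orthogonality, the improper integral picks out the coefficient \<open>a n\<close>.
\<close>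

lemma Ks_series_improper_integral:
  fixes a :: "nat \<Rightarrow> complex" and f :: "real \<Rightarrow> complex"
  assumes a: "summable (\<lambda>m. real (Suc m) * norm (a (Suc m)))"
    and f: "\<And>\<tau>. \<tau> > 0 \<Longrightarrow> f \<tau> = complex_of_real (\<tau> * sinh (pi * \<tau> / 2)) *
          (\<Sum>m. Ks (real (Suc m)) (\<i> * complex_of_real \<tau>) (arsinh pi) * a (Suc m))"
    and n: "n \<ge> 1"
  shows "has_improper_integral
            (\<lambda>\<tau>. complex_of_real (cosh (pi * \<tau> / 2)) *
                 macdonald (\<i> * complex_of_real \<tau>) (real n) * f \<tau>) (of_real (pi\<^sup>2 / 4 * real n) * a n)"
proof -
  define g where "g m u = of_real (sinh_mode (Suc m) u) * a (Suc m)" for m u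
  define B where "B m = cosh (arsinh pi) * (real (Suc m) * norm (a (Suc m)))" for m
  have B: "summable B" unfolding B_def by (rule summable_mult[OF a])
  have gB: "norm (g m u) \<le> B m" if "u \<in> {0..arsinh pi}" for m u
  proof -
    have "norm (g m u) \<le> (real (Suc m) * cosh (arsinh pi)) * norm (a (Suc m))"
      unfolding g_def norm_mult norm_of_real by (intro mult_right_mono abs_sinh_mode_le that) auto
    then show ?thesis by (simp add: B_def mult_ac)
  qed
  have cg: "continuous_on S (g m)" for S m unfolding g_def[abs_def] by (intro continuous_intros)
  define \<gamma> where "\<gamma> u = (\<Sum>m. g m u)" for u
  have c\<gamma>: "continuous_on {0..arsinh pi} \<gamma>"
    unfolding \<gamma>_def[abs_def] by (rule integral_suminf_uniform(1)[OF cg gB B])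
  have sumg: "summable (\<lambda>m. g m u)" if "u \<in> {0..arsinh pi}" for u
    by (rule summable_comparison_test'[OF B]) (use gB that in auto)
  have weighted: "(\<lambda>m. integral {0..arsinh pi} (\<lambda>u. g m u * of_real (h u))) sums integral {0..arsinh pi} (\<lambda>u. \<gamma> u * of_real (h u))"
    if h: "continuous_on {0..arsinh pi} h" "\<And>u. \<bar>h u\<bar> \<le> 1" for h :: "real \<Rightarrow> real"
  proof -
    have "(\<lambda>m. integral {0..arsinh pi} (\<lambda>u. g m u * of_real (h u))) sums
       integral {0..arsinh pi} (\<lambda>u. \<Sum>m. g m u * of_real (h u))"
    proof (rule integral_suminf_uniform(2)[OF _ _ B])
      show "continuous_on {0..arsinh pi} (\<lambda>u. g m u * of_real (h u))" for m
        by (intro continuous_intros cg h)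
      show "norm (g m u * of_real (h u)) \<le> B m" if "u \<in> {0..arsinh pi}" for m u
      proof -
        have "norm (g m u) * \<bar>h u\<bar> \<le> B m * 1"
          using gB[OF that, of m] h(2)[of u] by (intro mult_mono order_trans[OF norm_ge_zero gB[OF that]]) auto
        then show ?thesis by (simp add: norm_mult)
      qed
    qed
    also have "integral {0..arsinh pi} (\<lambda>u. \<Sum>m. g m u * of_real (h u)) = integral {0..arsinh pi} (\<lambda>u. \<gamma> u * of_real (h u))"
      unfolding \<gamma>_def by (intro Henstock_Kurzweil_Integration.integral_cong suminf_mult2[symmetric] sumg)
    finally show ?thesis .
  qed
  have f_eq: "f \<tau> = cosine_transform (arsinh pi) \<gamma> \<tau>" if "\<tau> > 0" for \<tau>
  proof -
    have "(\<lambda>m. integral {0..arsinh pi} (\<lambda>u. g m u * of_real (cos (\<tau> * u)))) sums cosine_transform (arsinh pi) \<gamma> \<tau>"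
      unfolding cosine_transform_def by (rule weighted) (auto intro!: continuous_intros)
    moreover have "integral {0..arsinh pi} (\<lambda>u. g m u * of_real (cos (\<tau> * u)))
        = of_real (\<tau> * sinh (pi * \<tau> / 2)) * (Ks (real (Suc m)) (\<i> * of_real \<tau>) (arsinh pi) * a (Suc m))" for m
    proof -
      have "integral {0..arsinh pi} (\<lambda>u. g m u * of_real (cos (\<tau> * u)))
        = cosine_transform (arsinh pi) (\<lambda>u. of_real (sinh_mode (Suc m) u)) \<tau> * a (Suc m)"
        unfolding cosine_transform_def integral_mult_left[symmetric] g_def
        by (intro Henstock_Kurzweil_Integration.integral_cong) (simp only: mult_ac)
      then show ?thesis unfolding Ks_cosine_transform[OF that, symmetric] by (simp only: mult_ac)
    qed
    ultimately have S: "(\<lambda>m. of_real (\<tau> * sinh (pi * \<tau> / 2)) * (Ks (real (Suc m)) (\<i> * of_real \<tau>) (arsinh pi) * a (Suc m)))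
       sums cosine_transform (arsinh pi) \<gamma> \<tau>" by (simp only:)
    have nz: "complex_of_real (\<tau> * sinh (pi * \<tau> / 2)) \<noteq> 0" using that by simp
    have "summable (\<lambda>m. Ks (real (Suc m)) (\<i> * of_real \<tau>) (arsinh pi) * a (Suc m))"
      using sums_summable[OF S] nz unfolding summable_cmult_iff by blast
    then show ?thesis unfolding f[OF that] using sums_unique[OF S] by (simp only: suminf_mult)
  qed
  define G where "G \<tau> = of_real (cosh (pi / 2 * \<tau>) * macdonald_im \<tau> (real n)) * cosine_transform (arsinh pi) \<gamma> \<tau>" for \<tau>
  have cG: "continuous_on S G" for S
    unfolding G_def[abs_def] using n
    by (intro continuous_intros cosine_transform_continuous[OF c\<gamma>]
      continuous_on_subset[OF macdonald_im_continuous]) auto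
  have eqG: "complex_of_real (cosh (pi * \<tau> / 2)) * macdonald (\<i> * complex_of_real \<tau>) (real n) * f \<tau> = G \<tau>"
    if "0 < \<tau>" for \<tau>
    using that by (simp add: G_def macdonald_eq f_eq)
  have "((\<lambda>N. integral {0..N} G) \<longlongrightarrow>
     of_real (pi / 2) * integral {0..arsinh pi} (\<lambda>u. \<gamma> u * of_real (rotated_kernel (real n) (pi / 2) u))) at_top"
    unfolding G_def[abs_def] using n arsinh_pi_nonneg by (intro cosine_transform_parseval c\<gamma>) auto
  also have "integral {0..arsinh pi} (\<lambda>u. \<gamma> u * of_real (rotated_kernel (real n) (pi / 2) u)) = of_real (real n * pi / 2) * a n"
  proof -
    have "(\<lambda>m. integral {0..arsinh pi} (\<lambda>u. g m u * of_real (cos (real n * sinh u)))) sums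
      integral {0..arsinh pi} (\<lambda>u. \<gamma> u * of_real (cos (real n * sinh u)))"
      by (rule weighted) (auto intro!: continuous_intros)
    moreover have "integral {0..arsinh pi} (\<lambda>u. g m u * of_real (cos (real n * sinh u)))
      = (if m = n - 1 then of_real (real n * pi / 2) * a n else 0)" for m
    proof -
      have "integral {0..arsinh pi} (\<lambda>u. g m u * of_real (cos (real n * sinh u)))
        = integral {0..arsinh pi} (\<lambda>u. complex_of_real (sinh_mode (Suc m) u * cos (real n * sinh u))) * a (Suc m)"
        unfolding integral_mult_left[symmetric] g_def
        by (intro Henstock_Kurzweil_Integration.integral_cong) (simp only: mult_ac of_real_mult)
      also have "\<dots> = (if Suc m = n then of_real (real n * pi / 2) else 0) * a (Suc m)"
        using n by (subst integral_sinh_mode_cos) auto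
      also have "\<dots> = (if m = n - 1 then of_real (real n * pi / 2) * a n else 0)" using n by auto
      finally show ?thesis .
    qed
    ultimately have "(\<lambda>m. if m = n - 1 then of_real (real n * pi / 2) * a n else 0) sums
      integral {0..arsinh pi} (\<lambda>u. \<gamma> u * of_real (cos (real n * sinh u)))" by (simp only:)
    from sums_unique2[OF this sums_single] show ?thesis by (simp only: rotated_kernel_half_pi)
  qed
  also have "complex_of_real (pi / 2) * (of_real (real n * pi / 2) * a n) = of_real (pi\<^sup>2 / 4 * real n) * a n"
    by (simp add: power2_eq_square)
  finally have lim: "((\<lambda>N. integral {0..N} G) \<longlongrightarrow> of_real (pi\<^sup>2 / 4 * real n) * a n) at_top" .
  show ?thesis
    unfolding has_improper_integral_def
  proof (intro conjI allI impI)
    fix N :: real assume "N > 0"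
    then show "interval_lebesgue_integrable lborel 0 (ereal N)
      (\<lambda>\<tau>. complex_of_real (cosh (pi * \<tau> / 2)) * macdonald (\<i> * complex_of_real \<tau>) (real n) * f \<tau>)"
      by (intro interval_integral_of_continuous(1)[where G=G] cG eqG) auto
  next
    have "\<forall>\<^sub>F N in at_top. integral {0..N} G = (LBINT \<tau>=0..ereal N.
       complex_of_real (cosh (pi * \<tau> / 2)) * macdonald (\<i> * complex_of_real \<tau>) (real n) * f \<tau>)"
      using eventually_ge_at_top[of 0]
      by eventually_elim (intro interval_integral_of_continuous(2)[symmetric] cG eqG)
    with lim show "((\<lambda>N. LBINT \<tau>=0..ereal N. complex_of_real (cosh (pi * \<tau> / 2)) *
       macdonald (\<i> * complex_of_real \<tau>) (real n) * f \<tau>) \<longlongrightarrow> of_real (pi\<^sup>2 / 4 * real n) * a n) at_top"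
      by (rule Lim_transform_eventually)
  qed
qed

section \<open>Series of Macdonald functions\<close>

lemma has_set_integral_of_tendsto:
  fixes q :: "real \<Rightarrow> complex"
  assumes q: "set_integrable lborel {0..} q"
    and lim: "((\<lambda>N. integral {0..N} q) \<longlongrightarrow> J) at_top"
  shows "set_lebesgue_integral lborel {0..} q = J"
proof (rule tendsto_unique)
  show "((\<lambda>N. set_lebesgue_integral lborel {0..N} q) \<longlongrightarrow> set_lebesgue_integral lborel {0..} q) at_top"
    by (rule tendsto_set_lebesgue_integral_at_top[OF _ q]) auto
  have "set_lebesgue_integral lborel {0..N} q = integral {0..N} q" for N
    by (rule set_borel_integral_eq_integral(2), rule set_integrable_subset[OF q]) auto
  with lim show "((\<lambda>N. set_lebesgue_integral lborel {0..N} q) \<longlongrightarrow> J) at_top" by simp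
qed simp

lemma set_integrable_exp_bound:
  fixes q :: "real \<Rightarrow> complex"
  assumes q: "continuous_on {0..} q" and d: "d > 0"
    and le: "\<And>t. t \<ge> 0 \<Longrightarrow> norm (q t) \<le> K * exp (- d * t)"
  shows "set_integrable lborel {0..} q"
    and "(LINT t:{0..}|lborel. norm (q t)) \<le> K / d"
proof -
  have meas: "set_borel_measurable lborel {0..} q"
    using borel_measurable_continuous_on_indicator[OF _ q] by (simp add: set_borel_measurable_def)
  have E: "set_integrable lborel {0<..} (\<lambda>t. K * exp (- (t * d)))"
    by (intro set_integrable_mult_right) (use integrable_I0i_exp_mscale[OF d] in simp)
  then have E': "set_integrable lborel {0..} (\<lambda>t. K * exp (- (t * d)))"
    by (simp only: set_integrable_Ioi_iff_Ici)
  show I: "set_integrable lborel {0..} q"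
  proof (rule set_integrable_bound[OF E' meas])
    have "norm (q t) \<le> norm (K * exp (- (t * d)))" if "t \<ge> 0" for t
      using le[OF that] by (simp add: mult.commute)
    then show "AE t in lborel. t \<in> {0..} \<longrightarrow> norm (q t) \<le> norm (K * exp (- (t * d)))" by auto
  qed
  have "(LINT t:{0..}|lborel. norm (q t)) \<le> (LINT t:{0..}|lborel. K * exp (- (t * d)))"
    by (rule set_integral_mono) (use le set_integrable_norm[OF I] E' in \<open>auto simp: mult.commute\<close>)
  also have "\<dots> = K * (LINT t:{0<..}|lborel. exp (- (t * d)))"
    unfolding set_integral_Ioi_eq_Ici[OF E', symmetric] by (rule set_integral_mult_right)
  also have "(LINT t:{0<..}|lborel. exp (- (t * d))) = 1 / d"
    using LBINT_I0i_exp_mscale[OF d] by (simp add: interval_lebesgue_integral_0_infty)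
  finally show "(LINT t:{0..}|lborel. norm (q t)) \<le> K / d" by simp
qed

lemma norm_cosine_transform_sinh_mode:
  "norm (cosine_transform (arsinh pi) (\<lambda>u. of_real (sinh_mode n u)) \<tau>) \<le> real n * cosh (arsinh pi) * arsinh pi"
proof -
  have "norm (cosine_transform (arsinh pi) (\<lambda>u. of_real (sinh_mode n u)) \<tau>) \<le> real n * cosh (arsinh pi) * (arsinh pi - 0)"
    unfolding cosine_transform_def
  proof (rule integral_bound[OF arsinh_pi_nonneg])
    fix u assume u: "u \<in> {0..arsinh pi}"
    have "\<bar>sinh_mode n u\<bar> * \<bar>cos (\<tau> * u)\<bar> \<le> real n * cosh (arsinh pi) * 1"
      by (intro mult_mono abs_sinh_mode_le u) auto
    then show "norm (complex_of_real (sinh_mode n u) * complex_of_real (cos (\<tau> * u))) \<le> real n * cosh (arsinh pi)"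
      by (simp add: norm_mult)
  qed (intro continuous_intros)
  then show ?thesis by simp
qed

text \<open>
  A rate \<open>\<beta>\<close> strictly between \<open>\<alpha>\<close> and \<open>pi / 2\<close> leaves a decaying factor, uniformly in \<open>x \<ge> 1\<close>.
\<close>

lemma cosh_mult_macdonald_decay:
  assumes "x \<ge> 1" "0 < \<alpha>" "\<alpha> < \<beta>" "\<beta> < pi / 2" "0 \<le> \<tau>"
  shows "\<bar>cosh (\<alpha> * \<tau>) * macdonald_im \<tau> x\<bar> \<le> 2 / cos \<beta> * exp (- (\<beta> - \<alpha>) * \<tau>)"
proof -
  have c: "cos \<beta> > 0" using assms by (intro cos_gt_zero_pi) auto
  have "exp (\<beta> * \<tau>) / 2 \<le> cosh (\<beta> * \<tau>)" by (simp add: cosh_field_def)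
  then have "exp (\<beta> * \<tau>) / 2 * \<bar>macdonald_im \<tau> x\<bar> \<le> cosh (\<beta> * \<tau>) * \<bar>macdonald_im \<tau> x\<bar>"
    by (intro mult_right_mono) auto
  also have "\<dots> \<le> 1 / (x * cos \<beta>)" using assms by (intro cosh_macdonald_bound) auto
  also have "\<dots> \<le> 1 / cos \<beta>" using assms c by (intro divide_left_mono) auto
  finally have "exp (\<beta> * \<tau>) * \<bar>macdonald_im \<tau> x\<bar> \<le> 2 / cos \<beta>" by simp
  then have "exp (- (\<beta> - \<alpha>) * \<tau>) * (exp (\<beta> * \<tau>) * \<bar>macdonald_im \<tau> x\<bar>) \<le> exp (- (\<beta> - \<alpha>) * \<tau>) * (2 / cos \<beta>)"
    by (intro mult_left_mono) auto
  moreover have "exp (- (\<beta> - \<alpha>) * \<tau>) * exp (\<beta> * \<tau>) = exp (\<alpha> * \<tau>)"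
    by (simp add: exp_add[symmetric] algebra_simps)
  moreover have "cosh (\<alpha> * \<tau>) \<le> exp (\<alpha> * \<tau>)"
  proof -
    have "exp (- (\<alpha> * \<tau>)) \<le> exp (\<alpha> * \<tau>)" using assms by simp
    then show ?thesis by (simp add: cosh_field_def)
  qed
  then have "cosh (\<alpha> * \<tau>) * \<bar>macdonald_im \<tau> x\<bar> \<le> exp (\<alpha> * \<tau>) * \<bar>macdonald_im \<tau> x\<bar>"
    by (intro mult_right_mono) auto
  ultimately show ?thesis by (simp add: abs_mult mult_ac)
qed

lemma summable_macdonald_series:
  fixes a :: "nat \<Rightarrow> complex"
  assumes "summable (\<lambda>m. norm (a (Suc m)))"
  shows "summable (\<lambda>m. a (Suc m) * macdonald (\<i> * complex_of_real \<tau>) (real (Suc m)))"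
proof (rule summable_comparison_test'[OF assms])
  fix m
  have "\<bar>macdonald_im \<tau> (real (Suc m))\<bar> \<le> 1 / real (Suc m)"
    using cosh_macdonald_bound[of "real (Suc m)" 0 \<tau>] by simp
  also have "\<dots> \<le> 1" by simp
  finally show "norm (a (Suc m) * macdonald (\<i> * complex_of_real \<tau>) (real (Suc m))) \<le> norm (a (Suc m))"
    unfolding macdonald_eq norm_mult norm_of_real by (intro mult_right_le_one_le) auto
qed

text \<open>
  For \<open>\<alpha> < pi / 2\<close> the terms of the integrand are bounded by \<open>norm (a m) * K * exp (- d * \<tau>)\<close> with
  constants \<open>K\<close> and \<open>d > 0\<close>, which justifies termwise integration; each term is given by the
  Parseval identity at \<open>\<beta> = \<alpha>\<close>.
\<close>

lemma macdonald_series_abel_integral: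
  fixes a :: "nat \<Rightarrow> complex" and f :: "real \<Rightarrow> complex" and n :: nat
  assumes a: "summable (\<lambda>m. norm (a (Suc m)))"
    and f: "\<And>\<tau>. \<tau> > 0 \<Longrightarrow> f \<tau> = (\<Sum>m. a (Suc m) * macdonald (\<i> * complex_of_real \<tau>) (real (Suc m)))"
    and \<alpha>: "0 < \<alpha>" "\<alpha> < pi / 2"
  defines "g \<equiv> \<lambda>\<tau>. complex_of_real (\<tau> * sinh (pi * \<tau> / 2) * cosh (\<alpha> * \<tau>)) *
                    Ks (real n) (\<i> * complex_of_real \<tau>) (arsinh pi) * f \<tau>"
  shows "interval_lebesgue_integrable lborel 0 \<infinity> g"
    and "(LBINT \<tau>=0..\<infinity>. g \<tau>) = (\<Sum>m. a (Suc m) * (of_real (pi / 2) *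
       integral {0..arsinh pi} (\<lambda>u. of_real (sinh_mode n u) * of_real (rotated_kernel (real (Suc m)) \<alpha> u))))"
proof -
  define c where "c = cosine_transform (arsinh pi) (\<lambda>u. of_real (sinh_mode n u))"
  have cm: "continuous_on S (\<lambda>u. complex_of_real (sinh_mode n u))" for S by (intro continuous_intros)
  have cc: "continuous_on S c" for S unfolding c_def by (rule cosine_transform_continuous[OF cm])
  define q where "q m \<tau> = a (Suc m) * (of_real (cosh (\<alpha> * \<tau>) * macdonald_im \<tau> (real (Suc m))) * c \<tau>)" for m \<tau>
  define \<beta> where "\<beta> = (\<alpha> + pi / 2) / 2"
  have \<beta>: "\<alpha> < \<beta>" "\<beta> < pi / 2" using \<alpha> by (simp_all add: \<beta>_def)
  define d where "d = \<beta> - \<alpha>"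
  have d: "d > 0" using \<beta> by (simp add: d_def)
  define K where "K = 2 / cos \<beta> * (real n * cosh (arsinh pi) * arsinh pi)"
  have cq: "continuous_on S (q m)" for S m
    unfolding q_def[abs_def]
    by (intro continuous_intros cc continuous_on_subset[OF macdonald_im_continuous]) auto
  have bound0: "norm (of_real (cosh (\<alpha> * \<tau>) * macdonald_im \<tau> (real (Suc m))) * c \<tau>) \<le> K * exp (- d * \<tau>)"
    if "\<tau> \<ge> 0" for m \<tau>
  proof -
    have "\<bar>cosh (\<alpha> * \<tau>) * macdonald_im \<tau> (real (Suc m))\<bar> * norm (c \<tau>)
      \<le> (2 / cos \<beta> * exp (- (\<beta> - \<alpha>) * \<tau>)) * (real n * cosh (arsinh pi) * arsinh pi)"
      unfolding c_def
    proof (intro mult_mono cosh_mult_macdonald_decay norm_cosine_transform_sinh_mode)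
      have "cos \<beta> > 0" using \<alpha> \<beta> by (intro cos_gt_zero_pi) auto
      then show "0 \<le> 2 / cos \<beta> * exp (- (\<beta> - \<alpha>) * \<tau>)" by simp
    qed (use \<alpha> \<beta> that in auto)
    then show ?thesis by (simp only: norm_mult norm_of_real K_def d_def mult_ac)
  qed
  have bound: "norm (q m \<tau>) \<le> (norm (a (Suc m)) * K) * exp (- d * \<tau>)" if "\<tau> \<ge> 0" for m \<tau>
    using mult_left_mono[OF bound0[OF that, of m] norm_ge_zero[of "a (Suc m)"]]
    unfolding q_def norm_mult[of "a (Suc m)"] by (simp only: mult.assoc)
  note I = set_integrable_exp_bound[OF cq d bound]
  have val: "set_lebesgue_integral lborel {0..} (q m) = a (Suc m) * (of_real (pi / 2) *
       integral {0..arsinh pi} (\<lambda>u. of_real (sinh_mode n u) * of_real (rotated_kernel (real (Suc m)) \<alpha> u)))" for m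
  proof (rule has_set_integral_of_tendsto[OF I(1)])
    have "((\<lambda>N. integral {0..N} (\<lambda>\<tau>. of_real (cosh (\<alpha> * \<tau>) * macdonald_im \<tau> (real (Suc m))) * c \<tau>))
      \<longlongrightarrow> of_real (pi / 2) * integral {0..arsinh pi} (\<lambda>u. of_real (sinh_mode n u) * of_real (rotated_kernel (real (Suc m)) \<alpha> u))) at_top"
      unfolding c_def using \<alpha> by (intro cosine_transform_parseval cm arsinh_pi_nonneg) auto
    from tendsto_mult[OF tendsto_const this, of "a (Suc m)"]
    show "((\<lambda>N. integral {0..N} (q m)) \<longlongrightarrow> a (Suc m) * (of_real (pi / 2) *
       integral {0..arsinh pi} (\<lambda>u. of_real (sinh_mode n u) * of_real (rotated_kernel (real (Suc m)) \<alpha> u)))) at_top"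
      unfolding q_def[abs_def] integral_mult_right .
  qed
  have sq: "summable (\<lambda>m. norm (q m \<tau>))" if "\<tau> \<ge> 0" for \<tau>
    by (rule summable_comparison_test'[where g = "\<lambda>m. (norm (a (Suc m)) * K) * exp (- d * \<tau>)"])
       (use bound[OF that] a in \<open>auto intro!: summable_mult2\<close>)
  have meas_int: "integrable lborel (\<lambda>\<tau>. indicator {0..} \<tau> *\<^sub>R q m \<tau>)" for m
    using I(1)[of m] by (simp add: set_integrable_def)
  have ae: "AE \<tau> in lborel. summable (\<lambda>m. norm (indicator {0..} \<tau> *\<^sub>R q m \<tau>))"
  proof (intro AE_I2)
    fix \<tau> :: real
    show "summable (\<lambda>m. norm (indicator {0..} \<tau> *\<^sub>R q m \<tau>))"
      using sq[of \<tau>] by (cases "\<tau> \<ge> 0") auto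
  qed
  have sint: "summable (\<lambda>m. \<integral>\<tau>. norm (indicator {0..} \<tau> *\<^sub>R q m \<tau>) \<partial>lborel)"
  proof (rule summable_comparison_test'[where g = "\<lambda>m. norm (a (Suc m)) * K / d"])
    show "summable (\<lambda>m. norm (a (Suc m)) * K / d)"
      by (intro summable_divide summable_mult2 a)
    show "norm (\<integral>\<tau>. norm (indicator {0..} \<tau> *\<^sub>R q m \<tau>) \<partial>lborel) \<le> norm (a (Suc m)) * K / d" for m
      using I(2)[of m] by (simp add: set_lebesgue_integral_def)
  qed
  define Q where "Q \<tau> = (\<Sum>m. q m \<tau>)" for \<tau>
  have ind: "(\<Sum>m. indicator {0..} \<tau> *\<^sub>R q m \<tau>) = indicator {0..} \<tau> *\<^sub>R Q \<tau>" for \<tau> :: real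
    by (cases "\<tau> \<ge> 0") (auto simp: Q_def)
  have Q: "set_integrable lborel {0..} Q"
    using integrable_suminf[OF meas_int ae sint] unfolding ind set_integrable_def .
  have Qval: "set_lebesgue_integral lborel {0..} Q = (\<Sum>m. set_lebesgue_integral lborel {0..} (q m))"
    using integral_suminf[OF meas_int ae sint] unfolding ind set_lebesgue_integral_def .
  have gQ: "g \<tau> = Q \<tau>" if "\<tau> > 0" for \<tau>
  proof -
    note S = summable_macdonald_series[OF a, of \<tau>]
    have "g \<tau> = of_real (cosh (\<alpha> * \<tau>)) * c \<tau> * f \<tau>"
      unfolding c_def Ks_cosine_transform[OF that, symmetric] g_def of_real_mult by (simp only: mult_ac)
    also have "\<dots> = (\<Sum>m. of_real (cosh (\<alpha> * \<tau>)) * c \<tau> * (a (Suc m) * macdonald (\<i> * complex_of_real \<tau>) (real (Suc m))))"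
      unfolding f[OF that] by (rule suminf_mult[OF S, symmetric])
    also have "\<dots> = Q \<tau>"
      unfolding Q_def q_def macdonald_eq of_real_mult by (simp only: mult_ac)
    finally show ?thesis .
  qed
  have "set_integrable lborel {0<..} Q" using Q by (simp only: set_integrable_Ioi_iff_Ici)
  then have "set_integrable lborel {0<..} g"
    using gQ set_integrable_cong[of lborel lborel "{0<..}" "{0<..}" g Q] by simp
  then show "interval_lebesgue_integrable lborel 0 \<infinity> g"
    by (simp add: interval_lebesgue_integral_0_infty)
  have "(LBINT \<tau>=0..\<infinity>. g \<tau>) = set_lebesgue_integral lborel {0<..} Q"
    unfolding interval_lebesgue_integral_0_infty by (rule set_lebesgue_integral_cong) (use gQ in auto)
  also have "\<dots> = set_lebesgue_integral lborel {0..} Q" by (rule set_integral_Ioi_eq_Ici[OF Q])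
  finally show "(LBINT \<tau>=0..\<infinity>. g \<tau>) = (\<Sum>m. a (Suc m) * (of_real (pi / 2) *
       integral {0..arsinh pi} (\<lambda>u. of_real (sinh_mode n u) * of_real (rotated_kernel (real (Suc m)) \<alpha> u))))"
    unfolding Qval val .
qed

lemma abs_rotated_kernel_le_1:
  assumes "x \<ge> 0" "0 \<le> \<alpha>" "\<alpha> \<le> pi / 2"
  shows "\<bar>rotated_kernel x \<alpha> u\<bar> \<le> 1"
proof -
  have "0 \<le> cos \<alpha>" using assms by (intro cos_ge_zero) auto
  then have "exp (- x * cos \<alpha> * cosh u) \<le> 1" using assms by simp
  then show ?thesis using abs_rotated_kernel_le[of x \<alpha> u] by linarith
qed

text \<open>
  As \<open>\<alpha>\<close> tends to \<open>pi / 2\<close> the rotated kernel tends to \<open>cos (m * sinh u)\<close> and orthogonality leaves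
  the single term with index \<open>n\<close>. Since the kernel is bounded by \<open>1\<close>, Tannery's theorem applies.
\<close>

lemma abel_series_limit:
  fixes a :: "nat \<Rightarrow> complex"
  assumes a: "summable (\<lambda>m. norm (a (Suc m)))" and n: "n \<ge> 1"
  shows "((\<lambda>\<alpha>. \<Sum>m. a (Suc m) * (of_real (pi / 2) *
       integral {0..arsinh pi} (\<lambda>u. of_real (sinh_mode n u) * of_real (rotated_kernel (real (Suc m)) \<alpha> u))))
     \<longlongrightarrow> of_real (pi\<^sup>2 / 4 * real n) * a n) (at_left (pi / 2))"
proof -
  define I where "I m \<alpha> = a (Suc m) * (of_real (pi / 2) *
       integral {0..arsinh pi} (\<lambda>u. complex_of_real (sinh_mode n u) * of_real (rotated_kernel (real (Suc m)) \<alpha> u)))" for m \<alpha>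
  define b where "b m = (if m = n - 1 then of_real (pi\<^sup>2 / 4 * real n) * a n else 0)" for m
  define B where "B = pi / 2 * (real n * cosh (arsinh pi) * arsinh pi)"
  have I_half: "I m (pi / 2) = b m" for m
  proof -
    have "I m (pi / 2) = a (Suc m) * (of_real (pi / 2) *
      integral {0..arsinh pi} (\<lambda>u. complex_of_real (sinh_mode n u * cos (real (Suc m) * sinh u))))"
      unfolding I_def rotated_kernel_half_pi of_real_mult ..
    also have "\<dots> = a (Suc m) * (of_real (pi / 2) * (if n = Suc m then of_real (real (Suc m) * pi / 2) else 0))"
      using n by (subst integral_sinh_mode_cos) auto
    also have "\<dots> = b m"
    proof (cases "n = Suc m")
      case True
      then show ?thesis by (simp add: b_def power2_eq_square)
    next
      case False
      then show ?thesis using n by (auto simp: b_def)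
    qed
    finally show ?thesis .
  qed
  have "((\<lambda>\<alpha>. I m \<alpha>) \<longlongrightarrow> b m) (at_left (pi / 2))" for m
  proof -
    have "continuous_on UNIV (I m)"
      unfolding I_def[abs_def] interval_cbox
      by (intro continuous_on_mult continuous_on_const integral_continuous_on_param)
         (auto intro!: continuous_intros rotated_kernel_continuous simp: split_beta)
    then have "(I m \<longlongrightarrow> I m (pi / 2)) (at (pi / 2))" by (auto simp: continuous_on_def)
    then show ?thesis unfolding I_half filterlim_at_split by simp
  qed
  moreover have "\<forall>\<^sub>F (m, \<alpha>) in at_top \<times>\<^sub>F at_left (pi / 2). norm (I m \<alpha>) \<le> norm (a (Suc m)) * B"
  proof -
    have le: "norm (I m \<alpha>) \<le> norm (a (Suc m)) * B" if "0 < \<alpha>" "\<alpha> < pi / 2" for m \<alpha>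
    proof -
      have "norm (integral {0..arsinh pi} (\<lambda>u. complex_of_real (sinh_mode n u) * of_real (rotated_kernel (real (Suc m)) \<alpha> u)))
        \<le> real n * cosh (arsinh pi) * (arsinh pi - 0)"
      proof (rule integral_bound[OF arsinh_pi_nonneg])
        show "continuous_on {0..arsinh pi} (\<lambda>u. complex_of_real (sinh_mode n u) * of_real (rotated_kernel (real (Suc m)) \<alpha> u))"
          by (intro continuous_intros rotated_kernel_continuous)
        fix u assume u: "u \<in> {0..arsinh pi}"
        have "\<bar>sinh_mode n u\<bar> * \<bar>rotated_kernel (real (Suc m)) \<alpha> u\<bar> \<le> real n * cosh (arsinh pi) * 1"
          using that by (intro mult_mono abs_sinh_mode_le u abs_rotated_kernel_le_1) auto
        then show "norm (complex_of_real (sinh_mode n u) * of_real (rotated_kernel (real (Suc m)) \<alpha> u)) \<le> real n * cosh (arsinh pi)"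
          by (simp add: norm_mult)
      qed
      then show ?thesis unfolding I_def B_def norm_mult norm_of_real
        by (intro mult_left_mono mult_mono) auto
    qed
    have "\<forall>\<^sub>F \<alpha> in at_left (pi / 2). 0 < \<alpha> \<and> \<alpha> < pi / 2"
      using eventually_at_left_real[of 0 "pi / 2"] by (auto elim!: eventually_mono)
    from eventually_prodI[OF eventually_True[of at_top] this]
    show ?thesis by (rule eventually_mono) (use le in auto)
  qed
  moreover have "summable (\<lambda>m. norm (a (Suc m)) * B)" by (rule summable_mult2[OF a])
  ultimately have "((\<lambda>\<alpha>. suminf (\<lambda>m. I m \<alpha>)) \<longlongrightarrow> suminf b) (at_left (pi / 2))"
    using tannerys_theorem[of I b "at_left (pi / 2)" "\<lambda>m. norm (a (Suc m)) * B"] by simp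
  also have "suminf b = of_real (pi\<^sup>2 / 4 * real n) * a n"
    unfolding b_def by (rule sums_unique[OF sums_single, symmetric])
  finally show ?thesis unfolding I_def .
qed

section \<open>The two expansions\<close>

theorem theorem7:
  fixes a :: "nat \<Rightarrow> complex" and f :: "real \<Rightarrow> complex"
  shows
    "((summable (\<lambda>m. real (Suc m) * norm (a (Suc m))) \<and>
       (\<forall>\<tau>>0. f \<tau> = complex_of_real (\<tau> * sinh (pi * \<tau> / 2)) *
          (\<Sum>m. Ks (real (Suc m)) (\<i> * complex_of_real \<tau>) (arsinh pi) * a (Suc m))))
      \<longrightarrow>
      (\<exists>J :: nat \<Rightarrow> complex.
         (\<forall>n\<ge>1. has_improper_integral
            (\<lambda>\<tau>. complex_of_real (cosh (pi * \<tau> / 2)) *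
                 macdonald (\<i> * complex_of_real \<tau>) (real n) * f \<tau>) (J n)) \<and>
         (\<forall>x>0. summable (\<lambda>n. 1 / of_nat (Suc n) *
                   Ks (real (Suc n)) (\<i> * complex_of_real x) (arsinh pi) * J (Suc n)) \<and>
            f x = complex_of_real (4 / pi\<^sup>2 * x * sinh (pi * x / 2)) *
              (\<Sum>n. 1 / of_nat (Suc n) *
                   Ks (real (Suc n)) (\<i> * complex_of_real x) (arsinh pi) * J (Suc n)))))
     \<and>
     ((summable (\<lambda>m. norm (a (Suc m))) \<and>
       (\<forall>\<tau>>0. f \<tau> = (\<Sum>m. a (Suc m) * macdonald (\<i> * complex_of_real \<tau>) (real (Suc m)))))
      \<longrightarrow>
      (\<exists>J :: nat \<Rightarrow> complex.
         (\<forall>n\<ge>1.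
            (\<forall>\<^sub>F \<alpha> in at_left (pi / 2). interval_lebesgue_integrable lborel 0 \<infinity>
               (\<lambda>\<tau>. complex_of_real (\<tau> * sinh (pi * \<tau> / 2) * cosh (\<alpha> * \<tau>)) *
                    Ks (real n) (\<i> * complex_of_real \<tau>) (arsinh pi) * f \<tau>)) \<and>
            ((\<lambda>\<alpha>. 2 * (LBINT \<tau>=0..\<infinity>.
                 complex_of_real (\<tau> * sinh (pi * \<tau> / 2) * cosh (\<alpha> * \<tau>)) *
                 Ks (real n) (\<i> * complex_of_real \<tau>) (arsinh pi) * f \<tau>)) \<longlongrightarrow> J n)
              (at_left (pi / 2))) \<and>
         (\<forall>x>0. summable (\<lambda>n. macdonald (\<i> * complex_of_real x) (real (Suc n)) /
                   of_nat (Suc n) * J (Suc n)) \<and>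
            f x = complex_of_real (2 / pi\<^sup>2) *
              (\<Sum>n. macdonald (\<i> * complex_of_real x) (real (Suc n)) /
                   of_nat (Suc n) * J (Suc n)))))"
proof (intro conjI impI; elim conjE)
  assume a: "summable (\<lambda>m. real (Suc m) * norm (a (Suc m)))"
    and f: "\<forall>\<tau>>0. f \<tau> = complex_of_real (\<tau> * sinh (pi * \<tau> / 2)) *
          (\<Sum>m. Ks (real (Suc m)) (\<i> * complex_of_real \<tau>) (arsinh pi) * a (Suc m))"
  define J where "J n = complex_of_real (pi\<^sup>2 / 4 * real n) * a n" for n
  have term_eq: "1 / of_nat (Suc n) * K * J (Suc n) = of_real (pi\<^sup>2 / 4) * (K * a (Suc n))" for n and K :: complex
    unfolding J_def of_real_mult of_real_of_nat_eq by (simp del: of_nat_Suc)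
  have improper: "\<forall>n\<ge>1. has_improper_integral
            (\<lambda>\<tau>. complex_of_real (cosh (pi * \<tau> / 2)) *
                 macdonald (\<i> * complex_of_real \<tau>) (real n) * f \<tau>) (J n)"
    unfolding J_def using Ks_series_improper_integral[OF a] f by blast
  have series: "summable (\<lambda>n. 1 / of_nat (Suc n) *
                   Ks (real (Suc n)) (\<i> * complex_of_real x) (arsinh pi) * J (Suc n)) \<and>
            f x = complex_of_real (4 / pi\<^sup>2 * x * sinh (pi * x / 2)) *
              (\<Sum>n. 1 / of_nat (Suc n) *
                   Ks (real (Suc n)) (\<i> * complex_of_real x) (arsinh pi) * J (Suc n))"
    if "x > 0" for x
  proof -
    let ?K = "\<lambda>n. Ks (real (Suc n)) (\<i> * complex_of_real x) (arsinh pi) * a (Suc n)"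
    define C where "C = arsinh pi / sinh (pi * x / 2)"
    have "summable (\<lambda>n. C * (real (Suc n) * norm (a (Suc n))))" by (rule summable_mult[OF a])
    then have S: "summable ?K"
    proof (rule summable_comparison_test')
      fix n
      have "norm (?K n) \<le> C * norm (a (Suc n))"
        unfolding norm_mult C_def by (intro mult_right_mono norm_Ks_le that) simp
      also have "\<dots> \<le> C * (real (Suc n) * norm (a (Suc n)))"
      proof (rule mult_left_mono)
        have "1 * norm (a (Suc n)) \<le> real (Suc n) * norm (a (Suc n))" by (intro mult_right_mono) auto
        then show "norm (a (Suc n)) \<le> real (Suc n) * norm (a (Suc n))" by simp
        show "0 \<le> C" unfolding C_def using that arsinh_pi_nonneg by (intro divide_nonneg_pos) auto
      qed
      finally show "norm (?K n) \<le> C * (real (Suc n) * norm (a (Suc n)))" .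
    qed
    have "f x = of_real (x * sinh (pi * x / 2)) * suminf ?K" using f that by blast
    also have "\<dots> = of_real (4 / pi\<^sup>2 * x * sinh (pi * x / 2)) * (of_real (pi\<^sup>2 / 4) * suminf ?K)"
      by simp
    also have "of_real (pi\<^sup>2 / 4) * suminf ?K = (\<Sum>n. of_real (pi\<^sup>2 / 4) * ?K n)"
      by (rule suminf_mult[OF S, symmetric])
    finally show ?thesis unfolding term_eq using summable_mult[OF S] by blast
  qed
  show "\<exists>J. (\<forall>n\<ge>1. has_improper_integral
            (\<lambda>\<tau>. complex_of_real (cosh (pi * \<tau> / 2)) *
                 macdonald (\<i> * complex_of_real \<tau>) (real n) * f \<tau>) (J n)) \<and>
         (\<forall>x>0. summable (\<lambda>n. 1 / of_nat (Suc n) *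
                   Ks (real (Suc n)) (\<i> * complex_of_real x) (arsinh pi) * J (Suc n)) \<and>
            f x = complex_of_real (4 / pi\<^sup>2 * x * sinh (pi * x / 2)) *
              (\<Sum>n. 1 / of_nat (Suc n) *
                   Ks (real (Suc n)) (\<i> * complex_of_real x) (arsinh pi) * J (Suc n)))"
    using improper series by blast
next
  assume a: "summable (\<lambda>m. norm (a (Suc m)))"
    and f: "\<forall>\<tau>>0. f \<tau> = (\<Sum>m. a (Suc m) * macdonald (\<i> * complex_of_real \<tau>) (real (Suc m)))"
  define J where "J n = complex_of_real (pi\<^sup>2 / 2 * real n) * a n" for n
  define g where "g n \<alpha> \<tau> = complex_of_real (\<tau> * sinh (pi * \<tau> / 2) * cosh (\<alpha> * \<tau>)) *
                    Ks (real n) (\<i> * complex_of_real \<tau>) (arsinh pi) * f \<tau>" for n \<alpha> \<tau>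
  have term_eq: "K / of_nat (Suc n) * J (Suc n) = of_real (pi\<^sup>2 / 2) * (a (Suc n) * K)" for n and K :: complex
    unfolding J_def of_real_mult of_real_of_nat_eq by (simp del: of_nat_Suc)
  have near: "\<forall>\<^sub>F \<alpha> in at_left (pi / 2). 0 < \<alpha> \<and> \<alpha> < pi / 2"
    using eventually_at_left_real[of 0 "pi / 2"] by (auto elim!: eventually_mono)
  have abel: "(\<forall>\<^sub>F \<alpha> in at_left (pi / 2). interval_lebesgue_integrable lborel 0 \<infinity> (g n \<alpha>)) \<and>
      ((\<lambda>\<alpha>. 2 * (LBINT \<tau>=0..\<infinity>. g n \<alpha> \<tau>)) \<longlongrightarrow> J n) (at_left (pi / 2))" if n: "n \<ge> 1" for n
  proof
    show "\<forall>\<^sub>F \<alpha> in at_left (pi / 2). interval_lebesgue_integrable lborel 0 \<infinity> (g n \<alpha>)"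
      using near unfolding g_def[abs_def]
      by eventually_elim (use f in \<open>blast intro: macdonald_series_abel_integral(1)[OF a]\<close>)
    define I where "I \<alpha> = (\<Sum>m. a (Suc m) * (of_real (pi / 2) *
       integral {0..arsinh pi} (\<lambda>u. of_real (sinh_mode n u) * of_real (rotated_kernel (real (Suc m)) \<alpha> u))))" for \<alpha>
    have "\<forall>\<^sub>F \<alpha> in at_left (pi / 2). 2 * I \<alpha> = 2 * (LBINT \<tau>=0..\<infinity>. g n \<alpha> \<tau>)"
      using near
    proof eventually_elim
      case (elim \<alpha>)
      have "(LBINT \<tau>=0..\<infinity>. g n \<alpha> \<tau>) = I \<alpha>"
        unfolding g_def I_def by (rule macdonald_series_abel_integral(2)[OF a]) (use f elim in auto)
      then show ?case by simp
    qed
    moreover have "((\<lambda>\<alpha>. 2 * I \<alpha>) \<longlongrightarrow> 2 * (of_real (pi\<^sup>2 / 4 * real n) * a n)) (at_left (pi / 2))"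
      unfolding I_def by (intro tendsto_mult tendsto_const abel_series_limit a n)
    then have "((\<lambda>\<alpha>. 2 * I \<alpha>) \<longlongrightarrow> J n) (at_left (pi / 2))" by (simp add: J_def mult_ac)
    ultimately show "((\<lambda>\<alpha>. 2 * (LBINT \<tau>=0..\<infinity>. g n \<alpha> \<tau>)) \<longlongrightarrow> J n) (at_left (pi / 2))"
      by (rule Lim_transform_eventually[rotated])
  qed
  have series: "summable (\<lambda>n. macdonald (\<i> * complex_of_real x) (real (Suc n)) /
                   of_nat (Suc n) * J (Suc n)) \<and>
            f x = complex_of_real (2 / pi\<^sup>2) *
              (\<Sum>n. macdonald (\<i> * complex_of_real x) (real (Suc n)) /
                   of_nat (Suc n) * J (Suc n))" if "x > 0" for x
  proof -
    let ?K = "\<lambda>n. a (Suc n) * macdonald (\<i> * complex_of_real x) (real (Suc n))"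
    have S: "summable ?K" by (rule summable_macdonald_series[OF a])
    have "f x = suminf ?K" using f that by blast
    also have "\<dots> = of_real (2 / pi\<^sup>2) * (of_real (pi\<^sup>2 / 2) * suminf ?K)"
      by simp
    also have "of_real (pi\<^sup>2 / 2) * suminf ?K = (\<Sum>n. of_real (pi\<^sup>2 / 2) * ?K n)"
      by (rule suminf_mult[OF S, symmetric])
    finally show ?thesis unfolding term_eq using summable_mult[OF S] by blast
  qed
  show "\<exists>J :: nat \<Rightarrow> complex.
         (\<forall>n\<ge>1.
            (\<forall>\<^sub>F \<alpha> in at_left (pi / 2). interval_lebesgue_integrable lborel 0 \<infinity>
               (\<lambda>\<tau>. complex_of_real (\<tau> * sinh (pi * \<tau> / 2) * cosh (\<alpha> * \<tau>)) *
                    Ks (real n) (\<i> * complex_of_real \<tau>) (arsinh pi) * f \<tau>)) \<and>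
            ((\<lambda>\<alpha>. 2 * (LBINT \<tau>=0..\<infinity>.
                 complex_of_real (\<tau> * sinh (pi * \<tau> / 2) * cosh (\<alpha> * \<tau>)) *
                 Ks (real n) (\<i> * complex_of_real \<tau>) (arsinh pi) * f \<tau>)) \<longlongrightarrow> J n)
              (at_left (pi / 2))) \<and>
         (\<forall>x>0. summable (\<lambda>n. macdonald (\<i> * complex_of_real x) (real (Suc n)) /
                   of_nat (Suc n) * J (Suc n)) \<and>
            f x = complex_of_real (2 / pi\<^sup>2) *
              (\<Sum>n. macdonald (\<i> * complex_of_real x) (real (Suc n)) /
                   of_nat (Suc n) * J (Suc n)))"
    using abel[unfolded g_def[abs_def]] series by blast
qed

end
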